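(* Let $n\ge4$, $S=\{1,\ldots,n\}$, let $\eta$ be a dihedral structure on $S$, and let $\gamma$ be either of the two cyclic structures underlying $\eta$. Then the cell-form $\omega_\gamma$ has simple poles along the boundary of the cell $X_{S,\eta}$ and no poles anywhere else; that is, $\omega_\gamma$ has a pole of order exactly $1$ along each boundary divisor of $\overline{\mathfrak{M}}_{0,n}$ bounding the cell $X_{S,\eta}$, and has no pole along any other boundary divisor of $\overline{\mathfrak{M}}_{0,n}$.
   Context: A cyclic structure on $S$ is a cyclic ordering $\gamma=(\gamma(1),\ldots,\gamma(n))$ of $S$ up to rotation; a dihedral structure is a cyclic ordering up to rotation and reversal, so each dihedral structure underlies two opposite cyclic structures. $\mathfrak{M}_{0,n}$ is the moduli space of genus $0$ curves with $n$ ordered marked points $z_1,\ldots,z_n$; normalizing $z_1=0$, $z_{n-1}=1$, $z_n=\infty$ and $t_i=z_{i+1}$ for $1\le i\le\ell=n-3$ gives coordinates on it. $\overline{\mathfrak{M}}_{0,n}$ is the Deligne–Mumford compactification; $\overline{\mathfrak{M}}_{0,n}\setminus\mathfrak{M}_{0,n}$ is a normal crossing divisor whose irreducible components (boundary divisors) correspond bijectively to partitions $S=S_1\sqcup S_2$ with $|S_1|,|S_2|\ge2$. The cell $X_{S,\eta}$ is the connected component of $\mathfrak{M}_{0,n}(\mathbb{R})$ of real marked points $z_1,\ldots,z_n\in\mathbb{P}^1(\mathbb{R})$ lying on the circle $\mathbb{P}^1(\mathbb{R})$ in the dihedral order $\eta$. The boundary divisors bounding it (those meeting its closure in codimension one)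 are those corresponding to partitions $S_1\sqcup S_2$ such that each $S_i$ consists of consecutive elements for $\eta$. The cell-form of $\gamma$: let $(\sigma(1),\ldots,\sigma(n))$ be the rotation of $\gamma$ with $\sigma(n)=n$; then $$\omega_\gamma=\frac{dt_1\cdots dt_\ell}{(z_{\sigma(2)}-z_{\sigma(1)})(z_{\sigma(3)}-z_{\sigma(2)})\cdots(z_{\sigma(n-1)}-z_{\sigma(n-2)})}.$$ *)

theory Defs
  imports "HOL-Analysis.Analysis" "Jordan_Normal_Form.Determinant"
begin

text \<open>
  Conventions. The set of labels is \<open>{1..n}\<close> and \<open>\<ell> = n - 3\<close>. Points of \<open>\<complex>\<^sup>\<ell>\<close> are
  extensional functions on \<open>{1..n - 3}\<close>; the Riemann sphere is the one-point compactification
  of \<open>\<complex>\<close>, with \<open>None\<close> playing the role of \<open>\<infinity>\<close>.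
\<close>

section \<open>Cyclic and dihedral structures\<close>

definition rotations :: "nat list \<Rightarrow> nat list set" where
  "rotations xs = {rotate k xs | k. True}"

text \<open>A cyclic or dihedral structure is the set of all lists representing it.\<close>

definition cyclic_structure :: "nat \<Rightarrow> nat list set \<Rightarrow> bool" where
  "cyclic_structure n C \<longleftrightarrow>
     (\<exists>xs. distinct xs \<and> set xs = {1..n} \<and> C = rotations xs)"

definition dihedral_structure :: "nat \<Rightarrow> nat list set \<Rightarrow> bool" where
  "dihedral_structure n E \<longleftrightarrow>
     (\<exists>xs. distinct xs \<and> set xs = {1..n} \<and> E = rotations xs \<union> rotations (rev xs))"

definition underlying_cyclic :: "nat \<Rightarrow> nat list set \<Rightarrow> nat list set \<Rightarrow> bool" where
  "underlying_cyclic n E C \<longleftrightarrow> cyclic_structure n C \<and> C \<subseteq> E"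


section \<open>Functions of several complex variables\<close>

definition cspace :: "nat \<Rightarrow> (nat \<Rightarrow> complex) topology" where
  "cspace l = product_topology (\<lambda>_. euclidean) {1..l}"

definition riemann_sphere :: "complex option topology" where
  "riemann_sphere = Alexandroff_compactification euclidean"

text \<open>Holomorphic on an open set \<open>U\<close>: continuous and holomorphic in each variable separately.\<close>

definition mholomorphic :: "nat \<Rightarrow> (nat \<Rightarrow> complex) set \<Rightarrow> ((nat \<Rightarrow> complex) \<Rightarrow> complex) \<Rightarrow> bool" where
  "mholomorphic l U f \<longleftrightarrow>
     continuous_map (subtopology (cspace l) U) euclidean f \<and>
     (\<forall>x\<in>U. \<forall>j\<in>{1..l}. (\<lambda>w. f (x(j := w))) field_differentiable at (x j))"

definition sphere_inverse :: "complex option \<Rightarrow> complex option" where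
  "sphere_inverse p =
     (case p of None \<Rightarrow> Some 0 | Some w \<Rightarrow> if w = 0 then None else Some (inverse w))"

text \<open>Holomorphic maps to the Riemann sphere, tested in the two standard charts \<open>w\<close> and \<open>1/w\<close>.\<close>

definition sphere_holomorphic ::
    "nat \<Rightarrow> (nat \<Rightarrow> complex) set \<Rightarrow> ((nat \<Rightarrow> complex) \<Rightarrow> complex option) \<Rightarrow> bool" where
  "sphere_holomorphic l U F \<longleftrightarrow>
     continuous_map (subtopology (cspace l) U) riemann_sphere F \<and>
     mholomorphic l {x\<in>U. F x \<noteq> None} (\<lambda>x. the (F x)) \<and>
     mholomorphic l {x\<in>U. F x \<noteq> Some 0} (\<lambda>x. the (sphere_inverse (F x)))"

definition pderiv_at :: "nat \<Rightarrow> ((nat \<Rightarrow> complex) \<Rightarrow> complex) \<Rightarrow> (nat \<Rightarrow> complex) \<Rightarrow> complex" where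
  "pderiv_at j f x = deriv (\<lambda>w. f (x(j := w))) (x j)"

text \<open>The determinant of \<open>(\<partial>F\<^sub>i/\<partial>x\<^sub>j)\<close> for \<open>1 \<le> i, j \<le> l\<close>; matrix indices start at 0.\<close>

definition jacobian ::
    "nat \<Rightarrow> (nat \<Rightarrow> (nat \<Rightarrow> complex) \<Rightarrow> complex) \<Rightarrow> (nat \<Rightarrow> complex) \<Rightarrow> complex" where
  "jacobian l F x =
     Determinant.det (Matrix.mat l l (\<lambda>(i, j). pderiv_at (Suc j) (F (Suc i)) x))"


section \<open>The moduli space and its compactification\<close>

text \<open>
  The finite marked points in normalised position: \<open>z\<^sub>1 = 0\<close>, \<open>z\<^sub>n\<^sub>-\<^sub>1 = 1\<close> and
  \<open>z\<^sub>i\<^sub>+\<^sub>1 = t\<^sub>i\<close> for \<open>1 \<le> i \<le> n - 3\<close>; the remaining one is \<open>z\<^sub>n = \<infinity>\<close>.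
\<close>

definition zfin :: "nat \<Rightarrow> (nat \<Rightarrow> complex) \<Rightarrow> nat \<Rightarrow> complex" where
  "zfin n t i = (if i = 1 then 0 else if i = n - 1 then 1 else t (i - 1))"

definition zpt :: "nat \<Rightarrow> (nat \<Rightarrow> complex) \<Rightarrow> nat \<Rightarrow> complex option" where
  "zpt n t i = (if i = n then None else Some (zfin n t i))"

text \<open>The space \<open>M\<^sub>0\<^sub>,\<^sub>n\<close> in the coordinates \<open>t\<close>.\<close>

definition M0 :: "nat \<Rightarrow> (nat \<Rightarrow> complex) set" where
  "M0 n = {t \<in> {1..n - 3} \<rightarrow>\<^sub>E UNIV. inj_on (zpt n t) {1..n}}"

text \<open>
  The cross-ratio \<open>(a - c)(b - d) / ((a - d)(b - c))\<close> of four distinct points of the sphere.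
  A factor involving \<open>\<infinity>\<close> is replaced by 1: of the two factors involving a given point, one is
  in the numerator and one in the denominator, and their quotient tends to 1.
\<close>

definition sphere_diff :: "complex option \<Rightarrow> complex option \<Rightarrow> complex" where
  "sphere_diff a b = (case (a, b) of (Some u, Some v) \<Rightarrow> u - v | _ \<Rightarrow> 1)"

definition cross_ratio ::
    "complex option \<Rightarrow> complex option \<Rightarrow> complex option \<Rightarrow> complex option \<Rightarrow> complex" where
  "cross_ratio a b c d =
     (sphere_diff a c * sphere_diff b d) / (sphere_diff a d * sphere_diff b c)"

type_synonym quad = "nat \<times> nat \<times> nat \<times> nat"

definition quads :: "nat \<Rightarrow> quad set" where
  "quads n = {(i, j, k, l). {i, j, k, l} \<subseteq> {1..n} \<and> distinct [i, j, k, l]}"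

definition cr_space :: "nat \<Rightarrow> (quad \<Rightarrow> complex option) topology" where
  "cr_space n = product_topology (\<lambda>_. riemann_sphere) (quads n)"

definition cr_embed :: "nat \<Rightarrow> (nat \<Rightarrow> complex) \<Rightarrow> quad \<Rightarrow> complex option" where
  "cr_embed n t =
     (\<lambda>(i, j, k, l)\<in>quads n. Some (cross_ratio (zpt n t i) (zpt n t j) (zpt n t k) (zpt n t l)))"

text \<open>
  The Deligne--Mumford compactification. The forgetful maps to the spaces
  \<open>M\<^sub>0\<^sub>,\<^sub>4\<close>-bar (the sphere), one for every four of the marked points, are the cross-ratios; they
  jointly define a closed embedding of the compactification into a product of spheres
  (Gerritzen, Herrlich and van der Put). As the open moduli space is dense, the image is the
  closure of the set of cross-ratio vectors of \<open>n\<close> distinct points. It is a closed complex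
  submanifold.
\<close>

definition M0_open :: "nat \<Rightarrow> (quad \<Rightarrow> complex option) set" where
  "M0_open n = cr_embed n ` M0 n"

definition M0_bar :: "nat \<Rightarrow> (quad \<Rightarrow> complex option) set" where
  "M0_bar n = cr_space n closure_of M0_open n"

definition M0_bar_top :: "nat \<Rightarrow> (quad \<Rightarrow> complex option) topology" where
  "M0_bar_top n = subtopology (cr_space n) (M0_bar n)"

text \<open>
  The boundary divisor of the partition \<open>S1 \<squnion> S2\<close> consists of the stable curves with a node
  that separates the points marked by \<open>S1\<close> from those marked by \<open>S2\<close>. For \<open>i, j \<in> S1\<close> and
  \<open>k, l \<in> S2\<close>, forgetting all other points gives the point of \<open>M\<^sub>0\<^sub>,\<^sub>4\<close>-bar at which \<open>i\<close> and \<open>j\<close>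
  (equivalently \<open>k\<close> and \<open>l\<close>) come together, where the cross-ratio is 1. Conversely the dual tree
  of a stable curve has an edge inducing \<open>S1 \<squnion> S2\<close> as soon as this holds for all such quadruples.
\<close>

definition bdry_divisor :: "nat \<Rightarrow> nat set \<Rightarrow> nat set \<Rightarrow> (quad \<Rightarrow> complex option) set" where
  "bdry_divisor n S1 S2 =
     {p \<in> M0_bar n. \<forall>i\<in>S1. \<forall>j\<in>S1. \<forall>k\<in>S2. \<forall>l\<in>S2. i \<noteq> j \<longrightarrow> k \<noteq> l \<longrightarrow> p (i, j, k, l) = Some 1}"

definition bdry_divisors :: "nat \<Rightarrow> (quad \<Rightarrow> complex option) set set" where
  "bdry_divisors n =
     {bdry_divisor n S1 S2 | S1 S2.
        S1 \<union> S2 = {1..n} \<and> S1 \<inter> S2 = {} \<and> 2 \<le> card S1 \<and> 2 \<le> card S2}"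


section \<open>Cells\<close>

text \<open>
  As \<open>z\<^sub>n = \<infinity>\<close>, real points lie on the circle in the dihedral order \<open>E\<close> iff for one of the two
  representatives of \<open>E\<close> ending in \<open>n\<close> (they differ by reversing the first \<open>n - 1\<close> entries)
  the finite points are increasing in that order.
\<close>

definition cell :: "nat \<Rightarrow> nat list set \<Rightarrow> (quad \<Rightarrow> complex option) set" where
  "cell n E =
     cr_embed n ` {t \<in> M0 n. (\<forall>i\<in>{1..n - 3}. t i \<in> \<real>) \<and>
       (\<exists>xs\<in>E. last xs = n \<and> sorted_wrt (<) (map (\<lambda>i. Re (zfin n t i)) (butlast xs)))}"

definition M0_bar_real :: "nat \<Rightarrow> (quad \<Rightarrow> complex option) set" where
  "M0_bar_real n = {p \<in> M0_bar n. \<forall>q\<in>quads n. p q \<in> insert None (Some ` \<real>)}"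

text \<open>
  The closure of the cell meets the divisor \<open>D\<close> in codimension one. The real locus of \<open>D\<close> is a
  real manifold of dimension \<open>n - 4\<close>, one less than that of the cell, so this says that the
  intersection contains a nonempty relatively open subset of the real locus of \<open>D\<close>.
\<close>

definition bounds_cell :: "nat \<Rightarrow> nat list set \<Rightarrow> (quad \<Rightarrow> complex option) set \<Rightarrow> bool" where
  "bounds_cell n E D \<longleftrightarrow>
     (\<exists>W. openin (M0_bar_top n) W \<and> W \<inter> D \<inter> M0_bar_real n \<noteq> {} \<and>
          W \<inter> D \<inter> M0_bar_real n \<subseteq> M0_bar_top n closure_of cell n E)"


section \<open>Order of a top-degree form along a divisor\<close>

text \<open>
  A holomorphic parametrisation \<open>\<phi>\<close> of an open subset of the compactification by an open subset
  \<open>U\<close> of \<open>\<complex>\<^sup>n\<^sup>-\<^sup>3\<close>, i.e. the inverse of a holomorphic chart. The last condition says that \<open>\<phi>\<close> is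
  an immersion; since \<open>(j, i, k, l)\<close> gives the inverse of the cross-ratio at \<open>(i, j, k, l)\<close>,
  nothing is lost by using only cross-ratios that are finite at the given point.
\<close>

definition holo_param ::
    "nat \<Rightarrow> (nat \<Rightarrow> complex) set \<Rightarrow> ((nat \<Rightarrow> complex) \<Rightarrow> quad \<Rightarrow> complex option) \<Rightarrow> bool" where
  "holo_param n U \<phi> \<longleftrightarrow>
     openin (cspace (n - 3)) U \<and>
     openin (M0_bar_top n) (\<phi> ` U) \<and>
     homeomorphic_map (subtopology (cspace (n - 3)) U) (subtopology (M0_bar_top n) (\<phi> ` U)) \<phi> \<and>
     (\<forall>q\<in>quads n. sphere_holomorphic (n - 3) U (\<lambda>x. \<phi> x q)) \<and>
     (\<forall>x\<in>U. \<exists>Q. (\<forall>i\<in>{1..n - 3}. Q i \<in> quads n \<and> \<phi> x (Q i) \<noteq> None) \<and>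
        jacobian (n - 3) (\<lambda>i y. the (\<phi> y (Q i))) x \<noteq> 0)"

text \<open>
  Local coordinates around a point of \<open>D\<close> that lies on no other boundary divisor, such that
  \<open>D\<close> is given by the equation \<open>x\<^sub>1 = 0\<close>.
\<close>

definition adapted_param ::
    "nat \<Rightarrow> (quad \<Rightarrow> complex option) set \<Rightarrow> (nat \<Rightarrow> complex) set \<Rightarrow>
     ((nat \<Rightarrow> complex) \<Rightarrow> quad \<Rightarrow> complex option) \<Rightarrow> bool" where
  "adapted_param n D U \<phi> \<longleftrightarrow>
     holo_param n U \<phi> \<and> (\<exists>x\<in>U. x 1 = 0) \<and>
     (\<forall>x\<in>U. (x 1 = 0 \<longleftrightarrow> \<phi> x \<in> D) \<and> (x 1 \<noteq> 0 \<longleftrightarrow> \<phi> x \<in> M0_open n))"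

text \<open>
  The coefficient of \<open>dx\<^sub>1 \<dots> dx\<^sub>n\<^sub>-\<^sub>3\<close> in the form \<open>h dt\<^sub>1 \<dots> dt\<^sub>n\<^sub>-\<^sub>3\<close>, at a point \<open>x\<close> with \<open>\<phi> x\<close> in the
  open moduli space.
\<close>

definition tcoord :: "nat \<Rightarrow> (quad \<Rightarrow> complex option) \<Rightarrow> nat \<Rightarrow> complex" where
  "tcoord n p = inv_into (M0 n) (cr_embed n) p"

definition pullback_coeff ::
    "nat \<Rightarrow> ((nat \<Rightarrow> complex) \<Rightarrow> complex) \<Rightarrow> ((nat \<Rightarrow> complex) \<Rightarrow> quad \<Rightarrow> complex option) \<Rightarrow>
     (nat \<Rightarrow> complex) \<Rightarrow> complex" where
  "pullback_coeff n h \<phi> x =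
     h (tcoord n (\<phi> x)) * jacobian (n - 3) (\<lambda>i y. tcoord n (\<phi> y) i) x"

text \<open>
  The form \<open>h dt\<^sub>1 \<dots> dt\<^sub>n\<^sub>-\<^sub>3\<close> has order \<open>k\<close> along \<open>D\<close>: near some point of \<open>D\<close> its coefficient is
  \<open>x\<^sub>1\<^sup>k\<close> times a nowhere vanishing holomorphic function. As \<open>D\<close> is irreducible, the order is the
  same at every point and in every chart, and a form of order \<open>k\<close> has this shape at a generic
  point of \<open>D\<close>; so it is enough to ask for one point and one chart.
\<close>

definition form_order ::
    "nat \<Rightarrow> ((nat \<Rightarrow> complex) \<Rightarrow> complex) \<Rightarrow> (quad \<Rightarrow> complex option) set \<Rightarrow> int \<Rightarrow> bool" where
  "form_order n h D k \<longleftrightarrow>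
     (\<exists>U \<phi> g. adapted_param n D U \<phi> \<and> mholomorphic (n - 3) U g \<and> (\<forall>x\<in>U. g x \<noteq> 0) \<and>
        (\<forall>x\<in>U. x 1 \<noteq> 0 \<longrightarrow> pullback_coeff n h \<phi> x = (x 1) powi k * g x))"

definition pole_of_order ::
    "nat \<Rightarrow> ((nat \<Rightarrow> complex) \<Rightarrow> complex) \<Rightarrow> (quad \<Rightarrow> complex option) set \<Rightarrow> nat \<Rightarrow> bool" where
  "pole_of_order n h D m \<longleftrightarrow> 0 < m \<and> form_order n h D (- int m)"

definition no_pole ::
    "nat \<Rightarrow> ((nat \<Rightarrow> complex) \<Rightarrow> complex) \<Rightarrow> (quad \<Rightarrow> complex option) set \<Rightarrow> bool" where
  "no_pole n h D \<longleftrightarrow> (\<exists>k\<ge>0. form_order n h D k)"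


section \<open>Cell-forms\<close>

definition rep_ending :: "nat \<Rightarrow> nat list set \<Rightarrow> nat list" where
  "rep_ending n C = (THE xs. xs \<in> C \<and> last xs = n)"

text \<open>The coefficient of \<open>dt\<^sub>1 \<dots> dt\<^sub>n\<^sub>-\<^sub>3\<close> in the cell-form; list positions start at 0.\<close>

definition cell_form :: "nat \<Rightarrow> nat list set \<Rightarrow> (nat \<Rightarrow> complex) \<Rightarrow> complex" where
  "cell_form n C t =
     (let xs = rep_ending n C
      in 1 / (\<Prod>i<n - 2. zfin n t (xs ! Suc i) - zfin n t (xs ! i)))"

end

theory Submission
  imports Defs
begin

text \<open>
  Let \<open>A\<close> be the side of the partition that does not contain \<open>n\<close>. Near a generic point of the
  boundary divisor the points marked by \<open>A\<close> are \<open>c + x\<^sub>1 w\<^sub>a\<close>, and \<open>x\<^sub>1 = 0\<close> is the divisor. In such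
  coordinates \<open>dt\<^sub>1 \<dots> dt\<^sub>\<ell>\<close> vanishes to order \<open>|A| - 2\<close>, while the denominator of the cell-form vanishes
  to the order given by the number of pairs of neighbours for \<open>\<gamma>\<close> that lie in \<open>A\<close>. That number is
  \<open>|A| - 1\<close> if \<open>A\<close> consists of consecutive elements and at most \<open>|A| - 2\<close> otherwise.

  If \<open>A\<close> is consecutive, points of the cell with small real \<open>x\<^sub>1\<close> of a suitable sign accumulate at an
  open part of the real divisor. Otherwise \<open>a < b < a'\<close> for some \<open>a, a' \<in> A\<close> and \<open>b \<notin> A\<close>,
  and the cross-ratio at \<open>(a, a', b, n)\<close> is negative on the cell but \<open>1\<close> on the divisor.
\<close>

section \<open>Holomorphic functions and the sphere\<close>

text \<open>The compactification is available only as a closure in a product of spheres, so a chart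
  needs an explicit inverse. Every coordinate of the chart is itself a cross-ratio
  (\<open>readout\<close>); that \<open>chart\<close> inverts \<open>readout\<close> is a
  computation on the open moduli space and extends to boundary points by density.

  The normalisation \<open>z_1 = 0\<close>, \<open>z_(n-1) = 1\<close> does not suit every divisor,
  since both labels may lie in \<open>A\<close> and collide there. The chart pins \<open>a0\<close>,
  \<open>b0\<close> and \<open>n\<close> instead, and the t_i return through an affine map with
  denominator \<open>scale\<close>. This may vanish on the divisor, but the Jacobian carries its
  power -(n-2) and the cell-form its power n-2, so only powers of \<open>x 1\<close> survive.

  The order |A| - 2 of the volume form arises because the centre and the scale of the cluster
  account for two of its points, while each of the others contributes one factor \<open>x 1\<close>.

  Since \<open>A\<close> avoids \<open>n\<close>, cutting the circle at \<open>n\<close> makes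
  consecutiveness a property of the linear list of the other labels.\<close>

lemma topspace_cspace [simp]: "topspace (cspace l) = {1..l} \<rightarrow>\<^sub>E UNIV"
  by (simp add: cspace_def)

lemma topspace_riemann_sphere [simp]: "topspace riemann_sphere = UNIV"
  by (auto simp: riemann_sphere_def notin_range_Some)

lemma topspace_cr_space [simp]: "topspace (cr_space n) = quads n \<rightarrow>\<^sub>E UNIV"
  by (simp add: cr_space_def)

lemma Hausdorff_riemann_sphere: "Hausdorff_space riemann_sphere"
  by (simp add: riemann_sphere_def Hausdorff_space_Alexandroff_compactification
      locally_compact_space_euclidean)

lemma openin_riemann_sphere_Some: "open U \<Longrightarrow> openin riemann_sphere (Some ` U)"
  by (simp add: riemann_sphere_def)

lemma continuous_map_Some_compose:
  "continuous_map X euclidean f \<Longrightarrow> continuous_map X riemann_sphere (\<lambda>x. Some (f x))"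
  unfolding riemann_sphere_def
  using continuous_map_compose[OF _ continuous_map_Some] by (force simp: o_def)

lemma continuous_map_the:
  "continuous_map (subtopology riemann_sphere (range Some)) euclidean the"
  unfolding continuous_map_def
proof (intro conjI allI impI)
  fix V :: "complex set"
  assume "openin euclidean V"
  then have "openin riemann_sphere (Some ` V)"
    by (simp add: openin_riemann_sphere_Some)
  moreover have "{x \<in> topspace (subtopology riemann_sphere (range Some)). the x \<in> V} = Some ` V \<inter> range Some"
    by auto
  ultimately show "openin (subtopology riemann_sphere (range Some))
      {x \<in> topspace (subtopology riemann_sphere (range Some)). the x \<in> V}"
    unfolding openin_subtopology by metis
qed auto

text \<open>The HOL function \<open>inverse\<close> sends 0 to 0 and is discontinuous there, so
  continuity is checked separately for neighbourhoods of finite points and of infinity.\<close>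

lemma continuous_map_sphere_inverse_Some:
  assumes f: "continuous_map X euclidean f"
  shows "continuous_map X riemann_sphere (\<lambda>x. sphere_inverse (Some (f x)))"
  unfolding continuous_map_def
proof (intro conjI allI impI)
  fix V assume "openin riemann_sphere V"
  then consider (fin) U where "V = Some ` U" "open U"
    | (inf) C where "V = insert None (Some ` (- C))" "compact C"
    by (auto simp: riemann_sphere_def openin_Alexandroff_compactification Compl_eq_Diff_UNIV)
  then have "\<exists>W. open W \<and> (\<forall>y. sphere_inverse (Some y) \<in> V \<longleftrightarrow> y \<in> W)"
  proof cases
    case fin
    have "open ({y. y \<noteq> 0} \<inter> inverse -` U)"
      using fin by (intro continuous_open_preimage)
        (auto intro!: continuous_intros simp: open_Collect_neq)
    then show ?thesis
      by (rule exI[of _ "{y. y \<noteq> 0} \<inter> inverse -` U", OF conjI])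
         (auto simp: fin sphere_inverse_def)
  next
    case inf
    \<comment> \<open>If 1/y lies in the compact set \<open>C\<close>, then |y| is at least 1/M.
      Restricting to this region keeps away from 0, where \<open>inverse\<close> is discontinuous,
      and loses no point of the preimage of \<open>C\<close>.\<close>
    obtain M where M: "M > 0" "\<And>c. c \<in> C \<Longrightarrow> norm c \<le> M"
      using compact_imp_bounded[OF inf(2)] by (auto simp: bounded_pos)
    have "closed ({y::complex. inverse M \<le> norm y} \<inter> inverse -` C)"
      using M by (intro continuous_closed_preimage)
        (auto intro!: continuous_on_inverse continuous_on_id closed_Collect_le continuous_on_const
          continuous_on_norm compact_imp_closed[OF inf(2)])
    moreover have "sphere_inverse (Some y) \<in> V \<longleftrightarrow> y \<in> - ({y::complex. inverse M \<le> norm y} \<inter> inverse -` C)" for y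
    proof -
      have "inverse M \<le> norm y" if "inverse y \<in> C" "y \<noteq> 0"
        using M(2)[OF that(1)] that(2) M(1) by (simp add: norm_divide divide_simps mult.commute)
      moreover have "\<not> inverse M \<le> 0" using M by simp
      ultimately show ?thesis by (auto simp: inf sphere_inverse_def)
    qed
    ultimately show ?thesis by (metis open_Compl)
  qed
  then obtain W where W: "open W" "\<And>y. sphere_inverse (Some y) \<in> V \<longleftrightarrow> y \<in> W" by blast
  then show "openin X {x \<in> topspace X. sphere_inverse (Some (f x)) \<in> V}"
    using f by (simp add: continuous_map_def)
qed auto

lemma mholomorphic_subset: "mholomorphic l U f \<Longrightarrow> V \<subseteq> U \<Longrightarrow> mholomorphic l V f"
  unfolding mholomorphic_def
  by (meson continuous_map_from_subtopology_mono subsetD)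

lemma mholomorphic_const: "mholomorphic l U (\<lambda>_. c)"
  by (simp add: mholomorphic_def)

lemma mholomorphic_coord:
  assumes "j \<in> {1..l}"
  shows "mholomorphic l U (\<lambda>x. x j)"
  unfolding mholomorphic_def
proof (intro conjI ballI)
  show "continuous_map (subtopology (cspace l) U) euclidean (\<lambda>x. x j)"
    using assms unfolding cspace_def
    by (intro continuous_map_from_subtopology continuous_map_product_projection) auto
  fix x i assume "x \<in> U" "i \<in> {1..l}"
  show "(\<lambda>w. (x(i := w)) j) field_differentiable at (x i)"
    by (cases "i = j") auto
qed

lemma mholomorphic_diff:
  assumes "mholomorphic l U f" "mholomorphic l U g"
  shows "mholomorphic l U (\<lambda>x. f x - g x)"
  using assms unfolding mholomorphic_def
  by (auto intro!: continuous_map_diff field_differentiable_diff)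

lemma mholomorphic_mult:
  assumes "mholomorphic l U f" "mholomorphic l U g"
  shows "mholomorphic l U (\<lambda>x. f x * g x)"
  using assms unfolding mholomorphic_def continuous_map_atin
  by (auto intro!: tendsto_mult field_differentiable_mult)

lemma mholomorphic_inverse:
  assumes "mholomorphic l U f" "\<And>x. x \<in> U \<Longrightarrow> f x \<noteq> 0"
  shows "mholomorphic l U (\<lambda>x. inverse (f x))"
  using assms unfolding mholomorphic_def continuous_map_atin
  by (auto intro!: tendsto_inverse field_differentiable_inverse)

lemma mholomorphic_divide:
  assumes "mholomorphic l U f" "mholomorphic l U g" "\<And>x. x \<in> U \<Longrightarrow> g x \<noteq> 0"
  shows "mholomorphic l U (\<lambda>x. f x / g x)"
  unfolding divide_inverse using assms by (intro mholomorphic_mult mholomorphic_inverse)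

lemma mholomorphic_prod:
  assumes "\<And>i. i \<in> I \<Longrightarrow> mholomorphic l U (f i)"
  shows "mholomorphic l U (\<lambda>x. \<Prod>i\<in>I. f i x)"
  using assms by (induction I rule: infinite_finite_induct)
    (auto intro: mholomorphic_mult mholomorphic_const)

lemma mholomorphic_the_sphere_inverse:
  assumes f: "mholomorphic l U f"
  shows "mholomorphic l {x\<in>U. f x \<noteq> 0} (\<lambda>x. the (sphere_inverse (Some (f x))))"
  unfolding mholomorphic_def
proof (intro conjI ballI)
  have inv: "mholomorphic l {x\<in>U. f x \<noteq> 0} (\<lambda>x. inverse (f x))"
    using f by (intro mholomorphic_inverse mholomorphic_subset[OF f]) auto
  then show "continuous_map (subtopology (cspace l) {x\<in>U. f x \<noteq> 0}) euclidean
      (\<lambda>x. the (sphere_inverse (Some (f x))))"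
    by (auto simp: mholomorphic_def sphere_inverse_def intro: continuous_map_eq)
  fix x j assume x: "x \<in> {x\<in>U. f x \<noteq> 0}" and j: "j \<in> {1..l}"
  have "(\<lambda>w. f (x(j := w))) field_differentiable at (x j)"
    using f x j by (simp add: mholomorphic_def)
  then have "continuous (at (x j)) (\<lambda>w. f (x(j := w)))"
    by (rule field_differentiable_imp_continuous_at)
  \<comment> \<open>Continuity keeps \<open>f\<close> nonzero near \<open>x j\<close>, so the case
    distinction in \<open>sphere_inverse\<close> disappears on a small disc.\<close>
  then obtain e where e: "e > 0" "\<And>w. dist (x j) w < e \<Longrightarrow> f (x(j := w)) \<noteq> 0"
    using continuous_at_avoid[of "x j" "\<lambda>w. f (x(j := w))" 0] x by auto
  show "(\<lambda>w. the (sphere_inverse (Some (f (x(j := w)))))) field_differentiable at (x j)"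
  proof (rule field_differentiable_transform_within[OF e(1)])
    show "(\<lambda>w. inverse (f (x(j := w)))) field_differentiable at (x j)"
      using inv x j by (simp add: mholomorphic_def)
    show "inverse (f (x(j := w))) = the (sphere_inverse (Some (f (x(j := w)))))"
      if "w \<in> UNIV" "dist w (x j) < e" for w
      using e(2)[of w] that by (simp add: sphere_inverse_def dist_commute)
  qed simp
qed

lemma sphere_holomorphic_Some:
  assumes f: "mholomorphic l U f"
  shows "sphere_holomorphic l U (\<lambda>x. Some (f x))"
  using assms mholomorphic_the_sphere_inverse[OF f]
  by (simp add: sphere_holomorphic_def mholomorphic_def[of l U] continuous_map_Some_compose)

text \<open>Inversion swaps the two standard charts of the sphere, so the two chart conditions
  merely trade places.\<close>

lemma sphere_holomorphic_sphere_inverse_Some: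
  assumes f: "mholomorphic l U f"
  shows "sphere_holomorphic l U (\<lambda>x. sphere_inverse (Some (f x)))"
proof -
  have "sphere_inverse (Some y) \<noteq> None \<longleftrightarrow> y \<noteq> 0" "sphere_inverse (Some y) \<noteq> Some 0"
    "the (sphere_inverse (sphere_inverse (Some y))) = y" for y
    by (auto simp: sphere_inverse_def)
  then show ?thesis
    using assms mholomorphic_the_sphere_inverse[OF f]
    by (simp add: sphere_holomorphic_def mholomorphic_def[of l U] continuous_map_sphere_inverse_Some)
qed

lemma openin_cspace_update:
  assumes V: "openin (cspace l) V" and x: "x \<in> V" and j: "j \<in> {1..l}"
  obtains \<delta> where "\<delta> > 0" "\<And>w. dist w (x j) < \<delta> \<Longrightarrow> x(j := w) \<in> V"
proof -
  have xt: "x \<in> {1..l} \<rightarrow>\<^sub>E UNIV"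
    using openin_subset[OF V] x by auto
  have "continuous_map euclidean (cspace l) (\<lambda>w. x(j := w))"
    unfolding cspace_def continuous_map_componentwise
    using xt j by (auto simp: fun_upd_def PiE_def extensional_def)
  then have "openin euclidean {w \<in> topspace euclidean. x(j := w) \<in> V}"
    using V by (rule openin_continuous_map_preimage)
  then have "open {w. x(j := w) \<in> V}" "x j \<in> {w. x(j := w) \<in> V}"
    using x by simp_all
  then show thesis
    using that unfolding open_dist by blast
qed

section \<open>Determinants, cross-ratios and cyclic orders\<close>

text \<open>Let \<open>q\<close> be a permutation whose term in the Leibniz formula is nonzero, and
  write \<open>q i = p k\<close>. Then \<open>k = i\<close> or \<open>k\<close> has smaller rank; in
  the latter case induction gives \<open>q k = p k = q i\<close>, and injectivity again yields
  \<open>k = i\<close>. So only \<open>p\<close> contributes. Ranks may repeat, so no linear order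
  of the rows has to be chosen.\<close>

lemma det_rank_triangular:
  fixes M :: "'a :: comm_ring_1 mat" and r :: "nat \<Rightarrow> nat"
  assumes M: "M \<in> carrier_mat n n" and p: "p permutes {0..<n}"
    and tri: "\<And>i k. i < n \<Longrightarrow> k < n \<Longrightarrow> M $$ (i, p k) \<noteq> 0 \<Longrightarrow> i = k \<or> r k < r i"
  shows "Determinant.det M = signof p * (\<Prod>i = 0..<n. M $$ (i, p i))"
proof -
  have zero: "(\<Prod>i = 0..<n. M $$ (i, q i)) = 0" if q: "q permutes {0..<n}" "q \<noteq> p" for q
  proof (rule ccontr)
    assume nz: "(\<Prod>i = 0..<n. M $$ (i, q i)) \<noteq> 0"
    have entry: "M $$ (i, q i) \<noteq> 0" if "i < n" for i
      using nz that prod_zero[of "{0..<n}" "\<lambda>i. M $$ (i, q i)"] by force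
    have "i < n \<longrightarrow> q i = p i" for i
    proof (induction "r i" arbitrary: i rule: less_induct)
      case less
      show ?case
      proof
        assume i: "i < n"
        have "q i \<in> {0..<n}" using q(1) i by (simp add: permutes_in_image)
        then have "q i \<in> p ` {0..<n}" using permutes_image[OF p] by simp
        then obtain k where k: "k < n" "q i = p k" by auto
        from tri[OF i k(1)] entry[OF i] k(2) consider "i = k" | "r k < r i" by auto
        then show "q i = p i"
        proof cases
          case 2
          from less[OF this] k have "q k = q i" by simp
          then have "k = i" using permutes_inj[OF q(1)] by (simp add: inj_eq)
          then show ?thesis using k by simp
        qed (use k in simp)
      qed
    qed
    moreover have "q i = p i" if "\<not> i < n" for i
      using that p q(1) by (simp add: permutes_def)
    ultimately show False using q(2) by blast
  qed
  have "Determinant.det M = (\<Sum>q | q permutes {0..<n}. signof q * (\<Prod>i = 0..<n. M $$ (i, q i)))"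
    by (rule det_def'[OF M])
  also have "\<dots> = (\<Sum>q | q permutes {0..<n}. if q = p then signof p * (\<Prod>i = 0..<n. M $$ (i, p i)) else 0)"
    using zero by (intro sum.cong) auto
  also have "\<dots> = signof p * (\<Prod>i = 0..<n. M $$ (i, p i))"
    using p finite_permutations[of "{0..<n}"] by (subst sum.delta) auto
  finally show ?thesis .
qed

section \<open>Cross-ratios of configurations with one point at infinity\<close>

definition mark :: "nat \<Rightarrow> (nat \<Rightarrow> complex) \<Rightarrow> nat \<Rightarrow> complex option" where
  "mark n z i = (if i = n then None else Some (z i))"

lemma zpt_eq_mark: "zpt n t = mark n (zfin n t)"
  by (simp add: fun_eq_iff zpt_def mark_def)

lemma sphere_diff_mark:
  "sphere_diff (mark n z i) (mark n z j) = (if i = n \<or> j = n then 1 else z i - z j)"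
  by (simp add: sphere_diff_def mark_def)

text \<open>Every label occurs once above and once below the fraction bar. Hence the powers of
  \<open>s\<close> cancel, also when one label is \<open>n\<close> and its two differences are
  replaced by 1.\<close>

lemma cross_ratio_mark_affine:
  assumes "s \<noteq> 0" "distinct [i, j, k, l]"
    and z': "\<And>m. m \<in> {i, j, k, l} - {n} \<Longrightarrow> z' m = (z m - c) / s"
  shows "cross_ratio (mark n z' i) (mark n z' j) (mark n z' k) (mark n z' l)
       = cross_ratio (mark n z i) (mark n z j) (mark n z k) (mark n z l)"
proof -
  have diff: "sphere_diff (mark n z' a) (mark n z' b)
      = sphere_diff (mark n z a) (mark n z b) / (if a = n \<or> b = n then 1 else s)"
    if "a \<in> {i, j, k, l}" "b \<in> {i, j, k, l}" for a b
    using that z'[of a] z'[of b] by (auto simp: sphere_diff_mark diff_divide_distrib)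
  show ?thesis
    using assms(1,2) by (auto simp: cross_ratio_def diff)
qed

text \<open>This rests on the identity (a - c)(b - d) - (a - d)(b - c) = (a - b)(c - d) and its
  degenerate forms with a point at infinity. It is what separates the open moduli space from the
  boundary divisors.\<close>

lemma cross_ratio_mark_neq_1:
  assumes "inj_on (mark n z) {i, j, k, l}" "distinct [i, j, k, l]"
  shows "cross_ratio (mark n z i) (mark n z j) (mark n z k) (mark n z l) \<noteq> 1"
proof
  assume 1: "cross_ratio (mark n z i) (mark n z j) (mark n z k) (mark n z l) = 1"
  have neq: "z a \<noteq> z b" if "a \<in> {i, j, k, l}" "b \<in> {i, j, k, l}" "a \<noteq> b" "a \<noteq> n" "b \<noteq> n" for a b
    using inj_onD[OF assms(1), of a b] that by (auto simp: mark_def)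
  have nz: "sphere_diff (mark n z a) (mark n z b) \<noteq> 0"
    if "a \<in> {i, j, k, l}" "b \<in> {i, j, k, l}" "a \<noteq> b" for a b
    using neq[of a b] that by (auto simp: sphere_diff_mark)
  have "sphere_diff (mark n z i) (mark n z k) * sphere_diff (mark n z j) (mark n z l)
      = sphere_diff (mark n z i) (mark n z l) * sphere_diff (mark n z j) (mark n z k)"
    using 1 nz[of i l] nz[of j k] assms(2) by (simp add: cross_ratio_def)
  note eq = this
  consider "i = n" | "j = n" | "k = n" | "l = n" | "i \<noteq> n" "j \<noteq> n" "k \<noteq> n" "l \<noteq> n" by blast
  then show False
  proof cases
    case 5
    then have "(z i - z j) * (z k - z l) = 0"
      using eq by (simp add: sphere_diff_mark algebra_simps)
    then show False using neq[of i j] neq[of k l] 5 assms(2) by auto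
  qed (use eq neq[of i j] neq[of k l] assms(2) in \<open>auto simp: sphere_diff_mark\<close>)
qed

section \<open>Cyclic orders cut open at the last label\<close>

lemma mem_rotations_iff: "xs \<in> rotations ys \<longleftrightarrow> (\<exists>k. xs = rotate k ys)"
  by (auto simp: rotations_def)

lemma rotations_trans: "zs \<in> rotations xs \<Longrightarrow> xs \<in> rotations ys \<Longrightarrow> zs \<in> rotations ys"
  unfolding mem_rotations_iff by (metis rotate_rotate)

lemma rotations_sym:
  assumes "xs \<in> rotations ys"
  shows "ys \<in> rotations xs"
proof -
  obtain k where xs: "xs = rotate k ys" using assms by (auto simp: mem_rotations_iff)
  \<comment> \<open>\<open>m\<close> completes \<open>k\<close> to a multiple of the length.\<close>
  define m where "m = length ys - k mod length ys"
  have "(m + k) mod length ys = 0" if "ys \<noteq> []"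
  proof -
    have "k mod length ys < length ys" using that by simp
    then have "m + k = length ys + (k - k mod length ys)"
      unfolding m_def using mod_less_eq_dividend[of k "length ys"] by linarith
    also have "k - k mod length ys = k div length ys * length ys"
      by (simp add: minus_mod_eq_div_mult)
    finally show ?thesis by simp
  qed
  then have "ys = rotate m xs"
    unfolding xs rotate_rotate by (cases "ys = []") auto
  then show ?thesis unfolding mem_rotations_iff by blast
qed

lemma rotations_eqI: "xs \<in> rotations ys \<Longrightarrow> rotations xs = rotations ys"
  using rotations_trans rotations_sym by blast

lemma rotations_self: "xs \<in> rotations xs"
  unfolding mem_rotations_iff by (rule exI[of _ 0]) simp

text \<open>Reversal turns a rotation by one step into a step backwards, which is again a rotation
  by \<open>rotations_sym\<close>.\<close>

lemma rev_mem_rotations: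
  assumes "xs \<in> rotations ys"
  shows "rev xs \<in> rotations (rev ys)"
proof -
  have "rev (rotate k ys) \<in> rotations (rev ys)" for k
  proof (induction k)
    case (Suc k)
    let ?zs = "rotate k ys"
    have "rev ?zs = rotate 1 (rev (rotate1 ?zs))" by (cases ?zs) auto
    then have "rev ?zs \<in> rotations (rev (rotate1 ?zs))" unfolding mem_rotations_iff by blast
    then have "rev (rotate1 ?zs) \<in> rotations (rev ?zs)" by (rule rotations_sym)
    then show ?case using Suc rotations_trans by fastforce
  qed (simp add: rotations_self)
  then show ?thesis using assms by (auto simp: mem_rotations_iff)
qed

lemma rotations_last_unique:
  assumes "distinct ys" "xs \<in> rotations ys" "xs' \<in> rotations ys" "last xs = last xs'"
  shows "xs = xs'"
proof (cases "ys = []")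
  case False
  obtain k k' where k: "xs = rotate k ys" "xs' = rotate k' ys"
    using assms by (auto simp: mem_rotations_iff)
  let ?n = "length ys"
  have n: "?n > 0" using False by simp
  have last: "last (rotate j ys) = ys ! ((j + (?n - 1)) mod ?n)" for j
    using False by (simp add: last_conv_nth nth_rotate)
  have "ys ! ((k + (?n - 1)) mod ?n) = ys ! ((k' + (?n - 1)) mod ?n)"
    using assms(4) unfolding k last .
  then have "(k + (?n - 1)) mod ?n = (k' + (?n - 1)) mod ?n"
    using assms(1) n nth_eq_iff_index_eq[OF assms(1)] by (metis mod_less_divisor)
  then have "(k + (?n - 1) + 1) mod ?n = (k' + (?n - 1) + 1) mod ?n"
    by (metis mod_add_left_eq)
  then have "(k + ?n) mod ?n = (k' + ?n) mod ?n" using n by (simp del: mod_add_self2)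
  then have "k mod ?n = k' mod ?n" by simp
  then show ?thesis unfolding k by (metis rotate_conv_mod)
qed (use assms in \<open>auto simp: mem_rotations_iff\<close>)

text \<open>Cutting at \<open>n\<close> replaces both structures by one list \<open>ys\<close>.
  Whichever of the two classes of \<open>E\<close> contains \<open>C\<close>, that class and its
  reversal together give back \<open>E\<close>.\<close>

lemma obtain_rep_ending:
  assumes "dihedral_structure n E" "underlying_cyclic n E C" "n \<ge> 1"
  obtains ys where "distinct (ys @ [n])" "set (ys @ [n]) = {1..n}"
    "rep_ending n C = ys @ [n]"
    "\<And>xs. xs \<in> E \<and> last xs = n \<longleftrightarrow> xs = ys @ [n] \<or> xs = rev ys @ [n]"
proof -
  obtain as where as: "distinct as" "set as = {1..n}" "E = rotations as \<union> rotations (rev as)"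
    using assms(1) by (auto simp: dihedral_structure_def)
  obtain zs where zs: "distinct zs" "set zs = {1..n}" "C = rotations zs" "C \<subseteq> E"
    using assms(2) by (auto simp: underlying_cyclic_def cyclic_structure_def)
  obtain us vs where uv: "zs = us @ n # vs"
    using assms(3) zs(2) by (metis atLeastAtMost_iff le_refl split_list)
  define ys where "ys = vs @ us"
  have "ys @ [n] = rotate (length (us @ [n])) zs"
    using rotate_append[of "us @ [n]" vs] by (simp add: uv ys_def)
  then have ysC: "ys @ [n] \<in> rotations zs" unfolding mem_rotations_iff by blast
  have C: "C = rotations (ys @ [n])" using rotations_eqI[OF ysC] zs(3) by simp
  have d: "distinct (ys @ [n])" and s: "set (ys @ [n]) = {1..n}"
    using zs(1,2) by (auto simp: uv ys_def)
  have "ys @ [n] \<in> E" using ysC zs(3,4) by blast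
  then have E: "E = rotations (ys @ [n]) \<union> rotations (rev (ys @ [n]))"
  proof -
    from \<open>ys @ [n] \<in> E\<close> consider "ys @ [n] \<in> rotations as" | "ys @ [n] \<in> rotations (rev as)"
      using as(3) by blast
    then show ?thesis
    proof cases
      case 1
      from rotations_eqI[OF 1] rotations_eqI[OF rev_mem_rotations[OF 1]] as(3) show ?thesis by simp
    next
      case 2
      from rotations_eqI[OF 2] rotations_eqI[OF rev_mem_rotations[OF 2]] as(3) show ?thesis
        by (simp add: Un_commute)
    qed
  qed
  \<comment> \<open>The reversed list starts with \<open>n\<close>; one rotation puts
    \<open>n\<close> back at the end.\<close>
  have "rev ys @ [n] = rotate 1 (rev (ys @ [n]))" by simp
  then have rv: "rev ys @ [n] \<in> rotations (rev (ys @ [n]))" unfolding mem_rotations_iff by blast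
  have uni: "xs = ys @ [n]" if "xs \<in> rotations (ys @ [n])" "last xs = n" for xs
    by (rule rotations_last_unique[OF d that(1) rotations_self]) (simp add: that(2))
  have uni': "xs = rev ys @ [n]" if "xs \<in> rotations (rev (ys @ [n]))" "last xs = n" for xs
    by (rule rotations_last_unique[OF _ that(1) rv]) (use that d in auto)
  show thesis
  proof (rule that[OF d s])
    show "rep_ending n C = ys @ [n]"
      unfolding rep_ending_def C
      using uni by (intro the_equality) (simp_all add: rotations_self)
    show "xs \<in> E \<and> last xs = n \<longleftrightarrow> xs = ys @ [n] \<or> xs = rev ys @ [n]" for xs
    proof
      assume "xs \<in> E \<and> last xs = n"
      then show "xs = ys @ [n] \<or> xs = rev ys @ [n]" unfolding E using uni uni' by blast
    next
      assume "xs = ys @ [n] \<or> xs = rev ys @ [n]"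
      then show "xs \<in> E \<and> last xs = n" unfolding E using rv rotations_self by fastforce
    qed
  qed
qed

text \<open>For a set that avoids \<open>n\<close>, being an interval of the list cut at
  \<open>n\<close> amounts to both blocks of the partition being arcs of the circle.\<close>

definition consecutive_in :: "'a list \<Rightarrow> 'a set \<Rightarrow> bool" where
  "consecutive_in xs A \<longleftrightarrow>
     (\<forall>p q r. p < q \<longrightarrow> q < r \<longrightarrow> r < length xs \<longrightarrow> xs ! p \<in> A \<longrightarrow> xs ! r \<in> A \<longrightarrow> xs ! q \<in> A)"

definition adjacent_in :: "'a list \<Rightarrow> 'a set \<Rightarrow> nat set" where
  "adjacent_in xs A = {i. Suc i < length xs \<and> xs ! i \<in> A \<and> xs ! Suc i \<in> A}"

text \<open>A position of \<open>A\<close> is counted unless its successor leaves \<open>A\<close>.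
  The last position of \<open>A\<close> is never counted; a gap costs at least one more, namely the
  last position before it.\<close>

lemma card_adjacent_in:
  assumes "distinct xs" "A \<subseteq> set xs" "A \<noteq> {}"
  shows "consecutive_in xs A \<Longrightarrow> card (adjacent_in xs A) + 1 = card A"
    and "\<not> consecutive_in xs A \<Longrightarrow> card (adjacent_in xs A) + 2 \<le> card A"
proof -
  define P where "P = {p. p < length xs \<and> xs ! p \<in> A}"
  have "bij_betw ((!) xs) P A"
    unfolding bij_betw_def P_def using assms(1,2)
    by (auto simp: inj_on_def nth_eq_iff_index_eq in_set_conv_nth subset_eq image_iff) 
  then have cardP: "card P = card A" by (rule bij_betw_same_card)
  have fin: "finite P" by (simp add: P_def)
  have "P \<noteq> {}" using assms(2,3) by (auto simp: P_def in_set_conv_nth subset_eq)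
  define m where "m = Max P"
  have m: "m \<in> P" "\<And>p. p \<in> P \<Longrightarrow> p \<le> m"
    unfolding m_def using fin \<open>P \<noteq> {}\<close> by auto
  have adj: "adjacent_in xs A = {p \<in> P. Suc p \<in> P}"
    by (auto simp: adjacent_in_def P_def)
  have sub: "adjacent_in xs A \<subseteq> P - {m}"
    unfolding adj using m(2) by fastforce
  have cm: "card (P - {m}) + 1 = card A"
    using m(1) fin cardP by (metis Suc_eq_plus1 card_Suc_Diff1)
  {
    assume c: "consecutive_in xs A"
    have "p \<in> adjacent_in xs A" if p: "p \<in> P - {m}" for p
    proof -
      have "p < m" using p m(2)[of p] by auto
      then have "Suc p = m \<or> Suc p < m" by auto
      then have "Suc p \<in> P"
        using c p m(1) unfolding consecutive_in_def P_def by auto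
      then show ?thesis using p by (simp add: adj)
    qed
    then show "card (adjacent_in xs A) + 1 = card A" using sub cm by (metis subsetI subset_antisym)
  }
  {
    assume "\<not> consecutive_in xs A"
    then obtain p q r where pqr: "p < q" "q < r" "p \<in> P" "r \<in> P" "q \<notin> P"
      unfolding consecutive_in_def P_def by fastforce
    \<comment> \<open>The last position of \<open>A\<close> before the gap at \<open>q\<close>; it
      differs from the overall maximum \<open>m\<close> because \<open>r\<close> comes
      later.\<close>
    define s where "s = Max {x \<in> P. x < q}"
    have "s \<in> {x \<in> P. x < q}"
      unfolding s_def using fin pqr by (intro Max_in) auto
    moreover have "x \<le> s" if "x \<in> P" "x < q" for x
      unfolding s_def using fin that by (intro Max_ge) auto
    ultimately have s: "s \<in> P" "s < q" "Suc s \<notin> P"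
      using pqr(5) by (auto, metis Suc_lessI not_less_eq_eq order_refl)
    have "s \<noteq> m" using m(2)[OF pqr(4)] s(2) pqr(2) by auto
    then have "adjacent_in xs A \<subset> P - {m}" using sub s by (auto simp: adj)
    then have "card (adjacent_in xs A) < card (P - {m})" using fin by (intro psubset_card_mono) auto
    then show "card (adjacent_in xs A) + 2 \<le> card A" using cm by simp
  }
qed

section \<open>The chart at a boundary divisor\<close>

declare One_nat_def [simp del]

section \<open>Cross-ratio vectors of smooth curves and their limits\<close>

lemma mem_quads:
  "(i, j, k, l) \<in> quads n \<longleftrightarrow> {i, j, k, l} \<subseteq> {1..n} \<and> distinct [i, j, k, l]"
  by (simp add: quads_def)

lemma cr_embed_apply:
  "(i, j, k, l) \<in> quads n \<Longrightarrow> cr_embed n t (i, j, k, l) =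
     Some (cross_ratio (mark n (zfin n t) i) (mark n (zfin n t) j) (mark n (zfin n t) k) (mark n (zfin n t) l))"
  by (simp add: cr_embed_def zpt_eq_mark)

lemma cr_embed_extensional: "cr_embed n t \<in> quads n \<rightarrow>\<^sub>E UNIV"
  by (simp add: cr_embed_def)

lemma inj_on_zfin: "t \<in> M0 n \<Longrightarrow> inj_on (zfin n t) {1..<n}"
  by (rule inj_onI, rule inj_onD[of "mark n (zfin n t)" "{1..n}"]) (auto simp: M0_def zpt_eq_mark mark_def)

lemma cr_embed_neq_1:
  assumes "t \<in> M0 n" "(i, j, k, l) \<in> quads n"
  shows "cr_embed n t (i, j, k, l) \<noteq> Some 1"
proof -
  have "inj_on (mark n (zfin n t)) {i, j, k, l}"
    using assms by (intro inj_on_subset[of _ "{1..n}" "{i, j, k, l}"]) (auto simp: M0_def zpt_eq_mark mem_quads)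
  then show ?thesis
    using cross_ratio_mark_neq_1 assms(2) by (simp add: cr_embed_apply mem_quads)
qed

text \<open>With the other three points at 1, 0 and infinity the cross-ratio is the coordinate
  itself, so the t_i can be read off from the embedding.\<close>

lemma cr_embed_coord:
  assumes n: "4 \<le> n" and i: "i \<in> {1..n - 3}"
  shows "cr_embed n t (Suc i, n - 1, 1, n) = Some (t i)"
proof -
  have "(Suc i, n - 1, 1, n) \<in> quads n" using n i by (auto simp: mem_quads)
  then show ?thesis
    using n i by (auto simp: cr_embed_apply cross_ratio_def sphere_diff_mark zfin_def)
qed

lemma inj_on_cr_embed: "4 \<le> n \<Longrightarrow> inj_on (cr_embed n) (M0 n)"
proof (rule inj_onI)
  fix s t assume n: "4 \<le> n" and st: "s \<in> M0 n" "t \<in> M0 n" "cr_embed n s = cr_embed n t"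
  show "s = t"
  proof (rule extensionalityI[of _ "{1..n - 3}"])
    show "s i = t i" if "i \<in> {1..n - 3}" for i
      using cr_embed_coord[OF n that, of s] cr_embed_coord[OF n that, of t] st(3) by simp
  qed (use st in \<open>auto simp: M0_def PiE_def\<close>)
qed

lemma tcoord_cr_embed: "4 \<le> n \<Longrightarrow> t \<in> M0 n \<Longrightarrow> tcoord n (cr_embed n t) = t"
  by (simp add: tcoord_def inj_on_cr_embed)

lemma M0_bar_subset: "M0_bar n \<subseteq> topspace (cr_space n)"
  unfolding M0_bar_def by (rule closure_of_subset_topspace)

lemma continuous_map_cr_proj:
  "q \<in> quads n \<Longrightarrow> continuous_map (cr_space n) riemann_sphere (\<lambda>p. p q)"
  unfolding cr_space_def by (rule continuous_map_product_projection)

text \<open>The symmetry is an identity of cross-ratios of distinct points and passes to the closure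
  because the sphere is Hausdorff. It makes a divisor independent of the order of its two blocks, so
  the block without \<open>n\<close> can be put first.\<close>

lemma M0_bar_swap:
  assumes p: "p \<in> M0_bar n" and q: "(i, j, k, l) \<in> quads n"
  shows "p (i, j, k, l) = p (k, l, i, j)"
proof (rule forall_in_closure_of_eq[OF p[unfolded M0_bar_def] Hausdorff_riemann_sphere])
  have q': "(k, l, i, j) \<in> quads n" using q by (auto simp: mem_quads)
  show "continuous_map (cr_space n) riemann_sphere (\<lambda>p. p (i, j, k, l))"
    "continuous_map (cr_space n) riemann_sphere (\<lambda>p. p (k, l, i, j))"
    using q q' by (auto intro: continuous_map_cr_proj)
  show "p (i, j, k, l) = p (k, l, i, j)" if "p \<in> M0_open n" for p
  proof -
    have anti: "sphere_diff (mark n z b) (mark n z a)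
        = (if a = n \<or> b = n then 1 else - 1) * sphere_diff (mark n z a) (mark n z b)" for z a b
      by (simp add: sphere_diff_mark)
    have "cross_ratio (mark n z i) (mark n z j) (mark n z k) (mark n z l)
        = cross_ratio (mark n z k) (mark n z l) (mark n z i) (mark n z j)" for z
      using q unfolding cross_ratio_def mem_quads anti[of z k i] anti[of z l j] anti[of z k j] anti[of z l i]
      by (cases "i = n"; cases "j = n"; cases "k = n"; cases "l = n") (simp_all add: mult.commute)
    then show ?thesis
      using that q q' by (auto simp: M0_open_def cr_embed_apply)
  qed
qed

lemma bdry_divisor_commute:
  assumes "S1 \<union> S2 = {1..n}" "S1 \<inter> S2 = {}"
  shows "bdry_divisor n S1 S2 = bdry_divisor n S2 S1"
proof -
  have "p (i, j, k, l) = p (k, l, i, j)"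
    if "p \<in> M0_bar n" "i \<in> S1" "j \<in> S1" "k \<in> S2" "l \<in> S2" "i \<noteq> j" "k \<noteq> l" for p i j k l
    using that assms by (intro M0_bar_swap) (auto simp: mem_quads)
  then show ?thesis unfolding bdry_divisor_def by (smt (verit) Collect_cong)
qed

text \<open>
  The first coordinate \<open>x 1\<close> is the scale of the cluster of points marked by \<open>A\<close>; the numbering \<open>e\<close>
  assigns it to the label \<open>a1\<close>.
\<close>

locale bdry_chart =
  fixes n :: nat and A :: "nat set" and a0 a1 b0 :: nat and e :: "nat \<Rightarrow> nat"
  assumes n4: "4 \<le> n" and A: "A \<subseteq> {1..<n}"
    and a01: "a0 \<in> A" "a1 \<in> A" "a0 \<noteq> a1" and b0: "b0 \<in> {1..<n}" "b0 \<notin> A"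
    and e: "bij_betw e ({1..<n} - {a0, b0}) {1..n - 3}" and e_a1: "e a1 = 1"
begin

abbreviation free :: "nat set" where "free \<equiv> {1..<n} - {a0, b0}"

text \<open>
  The points are normalised by \<open>z\<^bsub>a0\<^esub> = 0\<close>, \<open>z\<^bsub>b0\<^esub> = 1\<close>, \<open>z\<^sub>n = \<infinity>\<close> (so \<open>pos\<close> is \<open>z\<close> only up to an affine
  map), and \<open>loc\<close> describes the cluster after rescaling it to \<open>loc a0 = 0\<close>, \<open>loc a1 = 1\<close>. The
  differences \<open>sep\<close> are those of \<open>pos\<close> with the factor \<open>x 1\<close> removed.
\<close>

definition loc :: "(nat \<Rightarrow> complex) \<Rightarrow> nat \<Rightarrow> complex" where
  "loc x i = (if i = a0 then 0 else if i = a1 \<or> i = b0 then 1 else x (e i))"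

definition pos :: "(nat \<Rightarrow> complex) \<Rightarrow> nat \<Rightarrow> complex" where
  "pos x i = (if i \<in> A then x 1 * loc x i else loc x i)"

definition sep :: "(nat \<Rightarrow> complex) \<Rightarrow> nat \<Rightarrow> nat \<Rightarrow> complex" where
  "sep x i j = (if i = n \<or> j = n then 1
     else if i \<in> A \<and> j \<in> A then loc x i - loc x j else pos x i - pos x j)"

text \<open>Nothing forbids \<open>x 1 = 0\<close>. At such a point the rescaled cluster points are
  distinct, and so are the outer points and the point 0 to which the cluster shrinks: these are the
  curves with exactly one node.\<close>

definition cdom :: "(nat \<Rightarrow> complex) set" where
  "cdom = {x \<in> {1..n - 3} \<rightarrow>\<^sub>E UNIV. \<forall>i\<in>{1..n}. \<forall>j\<in>{1..n}. i \<noteq> j \<longrightarrow> sep x i j \<noteq> 0}"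

definition sepratio :: "(nat \<Rightarrow> complex) \<Rightarrow> nat \<Rightarrow> nat \<Rightarrow> nat \<Rightarrow> nat \<Rightarrow> complex" where
  "sepratio x i j k l = sep x i k * sep x j l / (sep x i l * sep x j k)"

text \<open>
  The exponent of \<open>x 1\<close> in the cross-ratio at \<open>(i, j, k, l)\<close> is
  \<open>([i \<in> A] - [j \<in> A]) ([k \<in> A] - [l \<in> A])\<close>.
\<close>

definition chart :: "(nat \<Rightarrow> complex) \<Rightarrow> quad \<Rightarrow> complex option" where
  "chart x = (\<lambda>(i, j, k, l)\<in>quads n.
     if (i \<in> A \<longleftrightarrow> j \<in> A) \<or> (k \<in> A \<longleftrightarrow> l \<in> A) then Some (sepratio x i j k l)
     else if i \<in> A \<longleftrightarrow> k \<in> A then Some (x 1 * sepratio x i j k l)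
     else sphere_inverse (Some (x 1 * sepratio x j i k l)))"

text \<open>The affine map taking \<open>pos x 1\<close> to 0 and \<open>pos x (n - 1)\<close> to 1
  recovers the t_i. The denominator may vanish when \<open>x 1 = 0\<close>, so this is used only off
  the divisor.\<close>

definition unscaled :: "(nat \<Rightarrow> complex) \<Rightarrow> nat \<Rightarrow> complex" where
  "unscaled x = (\<lambda>i\<in>{1..n - 3}. (pos x (Suc i) - pos x 1) / (pos x (n - 1) - pos x 1))"

text \<open>The cross-ratios that recover the coordinates.\<close>

definition label_quad :: "nat \<Rightarrow> quad" where
  "label_quad i = (if i \<in> A \<and> i \<noteq> a1 then (i, a1, a0, n) else (i, b0, a0, n))"

definition coord_quad :: "nat \<Rightarrow> quad" where
  "coord_quad j = label_quad (the_inv_into free e j)"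

definition readout :: "(quad \<Rightarrow> complex option) \<Rightarrow> nat \<Rightarrow> complex" where
  "readout p = (\<lambda>j\<in>{1..n - 3}. the (p (coord_quad j)))"

lemma n_notin_A: "n \<notin> A" using A by auto

lemma a1_free: "a1 \<in> free" using a01 b0 A by auto

lemma e_range: "i \<in> free \<Longrightarrow> e i \<in> {1..n - 3}"
  using e bij_betwE by blast

lemma e_eq_iff: "i \<in> free \<Longrightarrow> j \<in> free \<Longrightarrow> e i = e j \<longleftrightarrow> i = j"
  using e by (meson bij_betw_def inj_on_eq_iff)

lemma coord_label:
  assumes "j \<in> {1..n - 3}"
  obtains i where "i \<in> free" "e i = j" "coord_quad j = label_quad i"
  using assms that[of "the_inv_into free e j"] e unfolding coord_quad_def
  by (metis bij_betw_def f_the_inv_into_f the_inv_into_into order_refl)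

lemma coord_quad_e: "i \<in> free \<Longrightarrow> coord_quad (e i) = label_quad i"
  unfolding coord_quad_def using e by (metis bij_betw_def the_inv_into_f_f)

lemma label_quad_mem: "i \<in> free \<Longrightarrow> label_quad i \<in> quads n"
  unfolding label_quad_def using a01 b0 A n_notin_A by (auto simp: mem_quads)

lemma coord_quad_mem: "j \<in> {1..n - 3} \<Longrightarrow> coord_quad j \<in> quads n"
  by (metis coord_label label_quad_mem)

lemma loc_simps [simp]: "loc x a0 = 0" "loc x a1 = 1" "loc x b0 = 1"
  using a01 b0 by (auto simp: loc_def)

lemma loc_free: "i \<in> free \<Longrightarrow> i \<noteq> a1 \<Longrightarrow> loc x i = x (e i)"
  by (auto simp: loc_def)

lemma pos_a0 [simp]: "pos x a0 = 0"
  by (simp add: pos_def)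

lemma pos_b0 [simp]: "pos x b0 = 1"
  using b0 by (simp add: pos_def)

lemma pos_a1 [simp]: "pos x a1 = x 1"
  using a01 by (simp add: pos_def)

lemma sphere_diff_pos:
  "sphere_diff (mark n (pos x) i) (mark n (pos x) j) = (if i \<in> A \<and> j \<in> A then x 1 else 1) * sep x i j"
  using n_notin_A by (auto simp: sphere_diff_mark sep_def pos_def algebra_simps)

lemma sep_nz: "x \<in> cdom \<Longrightarrow> i \<in> {1..n} \<Longrightarrow> j \<in> {1..n} \<Longrightarrow> i \<noteq> j \<Longrightarrow> sep x i j \<noteq> 0"
  by (simp add: cdom_def)

lemma chart_apply: "(i, j, k, l) \<in> quads n \<Longrightarrow> chart x (i, j, k, l) =
    (if (i \<in> A \<longleftrightarrow> j \<in> A) \<or> (k \<in> A \<longleftrightarrow> l \<in> A) then Some (sepratio x i j k l)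
     else if i \<in> A \<longleftrightarrow> k \<in> A then Some (x 1 * sepratio x i j k l)
     else sphere_inverse (Some (x 1 * sepratio x j i k l)))"
  by (simp add: chart_def)

lemma chart_extensional: "chart x \<in> quads n \<rightarrow>\<^sub>E UNIV"
  by (simp add: chart_def)

lemma chart_eq_cross_ratio:
  assumes x: "x \<in> cdom" "x 1 \<noteq> 0" and q: "(i, j, k, l) \<in> quads n"
  shows "chart x (i, j, k, l) = Some (cross_ratio (mark n (pos x) i) (mark n (pos x) j)
           (mark n (pos x) k) (mark n (pos x) l))"
proof -
  have nz: "sep x i k \<noteq> 0" "sep x j l \<noteq> 0" "sep x i l \<noteq> 0" "sep x j k \<noteq> 0"
    by (rule sep_nz[OF x(1)]; use q in \<open>simp add: mem_quads\<close>)+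
  show ?thesis
    using x(2) nz
    by (auto simp: chart_apply[OF q] cross_ratio_def sphere_diff_pos sepratio_def sphere_inverse_def mult_ac)
qed

lemma inj_on_pos:
  assumes x: "x \<in> cdom" "x 1 \<noteq> 0"
  shows "inj_on (mark n (pos x)) {1..n}"
proof (rule inj_onI, rule ccontr)
  fix i j assume ij: "i \<in> {1..n}" "j \<in> {1..n}" "mark n (pos x) i = mark n (pos x) j" "i \<noteq> j"
  then have "i \<noteq> n" "j \<noteq> n" "pos x i = pos x j" by (auto simp: mark_def split: if_splits)
  then have "sphere_diff (mark n (pos x) i) (mark n (pos x) j) = 0"
    by (simp add: sphere_diff_mark)
  then show False
    using sep_nz[OF x(1) ij(1,2,4)] x(2) by (simp add: sphere_diff_pos split: if_splits)
qed

lemma scale_nz: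
  assumes x: "x \<in> cdom" "x 1 \<noteq> 0"
  shows "pos x (n - 1) - pos x 1 \<noteq> 0"
proof
  assume "pos x (n - 1) - pos x 1 = 0"
  then have "mark n (pos x) (n - 1) = mark n (pos x) 1" using n4 by (simp add: mark_def)
  then have "n - 1 = 1" using n4 by (intro inj_onD[OF inj_on_pos[OF x]]) auto
  then show False using n4 by simp
qed

lemma zfin_unscaled:
  assumes x: "x \<in> cdom" "x 1 \<noteq> 0" and i: "i \<in> {1..<n}"
  shows "zfin n (unscaled x) i = (pos x i - pos x 1) / (pos x (n - 1) - pos x 1)"
  using scale_nz[OF x] i by (auto simp: zfin_def unscaled_def)

lemma unscaled_mem_M0:
  assumes x: "x \<in> cdom" "x 1 \<noteq> 0"
  shows "unscaled x \<in> M0 n"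
proof -
  let ?f = "map_option (\<lambda>z. (z - pos x 1) / (pos x (n - 1) - pos x 1))"
  have eq: "mark n (zfin n (unscaled x)) i = ?f (mark n (pos x) i)" if "i \<in> {1..n}" for i
    using zfin_unscaled[OF x, of i] that by (simp add: mark_def)
  have inj: "inj ?f"
    by (intro option.inj_map injI) (use scale_nz[OF x] in auto)
  have "inj_on (mark n (zfin n (unscaled x))) {1..n}"
  proof (rule inj_onI)
    fix i j assume ij: "i \<in> {1..n}" "j \<in> {1..n}" "mark n (zfin n (unscaled x)) i = mark n (zfin n (unscaled x)) j"
    from ij(3) have "?f (mark n (pos x) i) = ?f (mark n (pos x) j)"
      unfolding eq[OF ij(1)] eq[OF ij(2)] .
    then have "mark n (pos x) i = mark n (pos x) j" by (rule injD[OF inj])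
    then show "i = j" using inj_onD[OF inj_on_pos[OF x]] ij by blast
  qed
  then show ?thesis
    by (simp add: M0_def zpt_eq_mark unscaled_def)
qed

lemma chart_eq_cr_embed:
  assumes x: "x \<in> cdom" "x 1 \<noteq> 0"
  shows "chart x = cr_embed n (unscaled x)"
proof (rule PiE_ext[OF chart_extensional cr_embed_extensional])
  fix q assume q: "q \<in> quads n"
  obtain i j k l where ijkl: "q = (i, j, k, l)" by (cases q)
  have "cross_ratio (mark n (zfin n (unscaled x)) i) (mark n (zfin n (unscaled x)) j)
      (mark n (zfin n (unscaled x)) k) (mark n (zfin n (unscaled x)) l)
    = cross_ratio (mark n (pos x) i) (mark n (pos x) j) (mark n (pos x) k) (mark n (pos x) l)"
    using q unfolding ijkl mem_quads
    by (intro cross_ratio_mark_affine[OF scale_nz[OF x], of _ _ _ _ _ _ _ "pos x 1"] zfin_unscaled[OF x]) force+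
  then show "chart x q = cr_embed n (unscaled x) q"
    using q unfolding ijkl by (simp add: cr_embed_apply chart_eq_cross_ratio[OF x])
qed

lemma tcoord_chart: "x \<in> cdom \<Longrightarrow> x 1 \<noteq> 0 \<Longrightarrow> tcoord n (chart x) = unscaled x"
  by (simp add: chart_eq_cr_embed tcoord_cr_embed n4 unscaled_mem_M0)

lemma chart_mem_M0_open: "x \<in> cdom \<Longrightarrow> x 1 \<noteq> 0 \<Longrightarrow> chart x \<in> M0_open n"
  by (simp add: M0_open_def chart_eq_cr_embed unscaled_mem_M0)

text \<open>The quadruple \<open>(i, a1, a0, n)\<close> measures a cluster point in units of the
  cluster, and \<open>(i, b0, a0, n)\<close> an outer point in outer units. For
  \<open>i = a1\<close> the latter compares the two units, which is \<open>x 1\<close>.\<close>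

lemma chart_label_quad:
  assumes i: "i \<in> free"
  shows "chart x (label_quad i) = Some (x (e i))"
proof -
  have q: "label_quad i \<in> quads n" using i by (rule label_quad_mem)
  have n: "i \<noteq> n" "a0 \<noteq> n" "a1 \<noteq> n" "b0 \<noteq> n" using i n_notin_A a01 b0 by auto
  consider "i = a1" | "i \<in> A" "i \<noteq> a1" | "i \<notin> A" by blast
  then show ?thesis
  proof cases
    case 1
    have lab: "label_quad i = (a1, b0, a0, n)" by (simp add: label_quad_def 1)
    have "chart x (a1, b0, a0, n) = Some (x 1 * sepratio x a1 b0 a0 n)"
      using q a01 b0 n_notin_A unfolding lab by (simp only: chart_apply) simp
    also have "sepratio x a1 b0 a0 n = 1"
      using a01 b0 n by (simp add: sepratio_def sep_def)
    finally show ?thesis unfolding lab by (simp add: 1 e_a1)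
  next
    case 2
    then show ?thesis
      using q a01 b0 n n_notin_A i unfolding label_quad_def
      by (simp add: chart_apply sepratio_def sep_def loc_free)
  next
    case 3
    then have "i \<noteq> a1" using a01 by auto
    then show ?thesis
      using 3 q a01 b0 n n_notin_A i unfolding label_quad_def
      by (simp add: chart_apply sepratio_def sep_def loc_free pos_def[of _ i])
  qed
qed

lemma chart_coord_quad: "j \<in> {1..n - 3} \<Longrightarrow> chart x (coord_quad j) = Some (x j)"
  by (elim coord_label) (simp add: chart_label_quad)

lemma readout_chart: "x \<in> {1..n - 3} \<rightarrow>\<^sub>E UNIV \<Longrightarrow> readout (chart x) = x"
  by (intro extensionalityI[of _ "{1..n - 3}"]) (auto simp: readout_def chart_coord_quad PiE_def)

lemma readout_extensional: "readout p \<in> {1..n - 3} \<rightarrow>\<^sub>E UNIV"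
  by (simp add: readout_def)

lemma readout_e: "i \<in> free \<Longrightarrow> readout p (e i) = the (p (label_quad i))"
  using e_range coord_quad_e by (simp add: readout_def)

text \<open>Any configuration of distinct points can be moved affinely to \<open>a0\<close> at 0 and
  \<open>b0\<close> at 1. Thus the chart covers the whole open moduli space, and
  \<open>readout\<close> inverts it there.\<close>

lemma readout_cr_embed:
  assumes t: "t \<in> M0 n"
  defines "x \<equiv> readout (cr_embed n t)" and "z \<equiv> zfin n t"
  shows "i \<in> {1..<n} \<Longrightarrow> pos x i = (z i - z a0) / (z b0 - z a0)"
    and "x 1 \<noteq> 0" and "x \<in> cdom" and "chart x = cr_embed n t"
proof -
  have ne: "z i \<noteq> z j" if "i \<in> {1..<n}" "j \<in> {1..<n}" "i \<noteq> j" for i j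
    using inj_on_zfin[OF t] that unfolding z_def by (auto dest: inj_onD)
  have lab: "a0 \<in> {1..<n}" "a1 \<in> {1..<n}" "b0 \<in> {1..<n}" "a0 \<noteq> b0" "a1 \<noteq> b0" using a01 b0 A by auto
  have xe: "x (e i) = (if i \<in> A \<and> i \<noteq> a1 then (z i - z a0) / (z a1 - z a0) else (z i - z a0) / (z b0 - z a0))"
    if i: "i \<in> free" for i
    using label_quad_mem[OF i] i lab unfolding x_def readout_e[OF i] label_quad_def z_def
    by (auto simp: cr_embed_apply cross_ratio_def sphere_diff_mark)
  have x1: "x 1 = (z a1 - z a0) / (z b0 - z a0)"
    using xe[OF a1_free] by (simp add: e_a1)
  show x1nz: "x 1 \<noteq> 0"
    unfolding x1 using ne lab a01 by simp
  have locA: "loc x i = (z i - z a0) / (z a1 - z a0)" if "i \<in> A" for i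
    using that xe[of i] b0 A ne[of a1 a0] lab a01 by (auto simp: loc_def)
  have locB: "loc x i = (z i - z a0) / (z b0 - z a0)" if "i \<in> {1..<n} - A" for i
    using that xe[of i] b0 ne[of b0 a0] lab a01 by (auto simp: loc_def)
  show posx: "pos x i = (z i - z a0) / (z b0 - z a0)" if i: "i \<in> {1..<n}" for i
  proof (cases "i \<in> A")
    case True
    then show ?thesis using ne[of a1 a0] lab a01 by (simp add: pos_def x1 locA)
  qed (use i locB in \<open>auto simp: pos_def\<close>)
  show xd: "x \<in> cdom"
    unfolding cdom_def
  proof (intro CollectI conjI ballI impI)
    fix i j assume ij: "i \<in> {1..n}" "j \<in> {1..n}" "i \<noteq> j"
    show "sep x i j \<noteq> 0"
    proof (cases "i = n \<or> j = n")
      case False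
      then have "pos x i \<noteq> pos x j"
        using ij ne[of i j] ne[of b0 a0] lab by (simp add: posx)
      then have "sphere_diff (mark n (pos x) i) (mark n (pos x) j) \<noteq> 0"
        using False by (simp add: sphere_diff_mark)
      then show ?thesis by (simp add: sphere_diff_pos)
    qed (simp add: sep_def)
  qed (simp add: x_def readout_extensional)
  show "chart x = cr_embed n t"
  proof (rule PiE_ext[OF chart_extensional cr_embed_extensional])
    fix q assume q: "q \<in> quads n"
    obtain i j k l where ijkl: "q = (i, j, k, l)" by (cases q)
    have "cross_ratio (mark n (pos x) i) (mark n (pos x) j) (mark n (pos x) k) (mark n (pos x) l)
      = cross_ratio (mark n z i) (mark n z j) (mark n z k) (mark n z l)"
      using q ne[of b0 a0] lab unfolding ijkl mem_quads
      by (intro cross_ratio_mark_affine[of "z b0 - z a0" _ _ _ _ _ _ _ "z a0"] posx) force+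
    then show "chart x q = cr_embed n t q"
      using q unfolding ijkl by (simp add: cr_embed_apply chart_eq_cross_ratio[OF xd x1nz] z_def)
  qed
qed

end

section \<open>The chart is a local parametrisation\<close>

context bdry_chart
begin

lemma one_coord: "1 \<in> {1..n - 3}"
  using n4 by simp

lemma mholomorphic_loc:
  assumes "i \<in> {1..<n}"
  shows "mholomorphic (n - 3) S (\<lambda>x. loc x i)"
proof (cases "i \<in> free \<and> i \<noteq> a1")
  case True
  then have "mholomorphic (n - 3) S (\<lambda>x. x (e i))"
    by (intro mholomorphic_coord e_range) auto
  then show ?thesis using True by (simp add: loc_free)
next
  case False
  then have "i = a0 \<or> i = a1 \<or> i = b0" using assms by auto
  then show ?thesis by (auto simp: mholomorphic_const)
qed

lemma mholomorphic_pos: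
  assumes "i \<in> {1..<n}"
  shows "mholomorphic (n - 3) S (\<lambda>x. pos x i)"
proof (cases "i \<in> A")
  case True
  then show ?thesis
    using mholomorphic_mult[OF mholomorphic_coord[OF one_coord] mholomorphic_loc[OF assms]]
    by (simp add: pos_def)
qed (use mholomorphic_loc[OF assms] in \<open>simp add: pos_def\<close>)

lemma mholomorphic_sep:
  assumes "i \<in> {1..n}" "j \<in> {1..n}"
  shows "mholomorphic (n - 3) S (\<lambda>x. sep x i j)"
proof (cases "i = n \<or> j = n")
  case False
  then have ij: "i \<in> {1..<n}" "j \<in> {1..<n}" using assms by auto
  show ?thesis
    using False mholomorphic_diff[OF mholomorphic_loc[OF ij(1)] mholomorphic_loc[OF ij(2)], of S]
      mholomorphic_diff[OF mholomorphic_pos[OF ij(1)] mholomorphic_pos[OF ij(2)], of S]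
    by (cases "i \<in> A"; cases "j \<in> A") (simp_all add: sep_def)
qed (simp add: sep_def mholomorphic_const)

lemma openin_cdom: "openin (cspace (n - 3)) cdom"
proof -
  have *: "openin (cspace (n - 3)) {x \<in> topspace (cspace (n - 3)). sep x i j \<noteq> 0}"
    if "i \<in> {1..n}" "j \<in> {1..n}" for i j
  proof -
    have "continuous_map (cspace (n - 3)) euclidean (\<lambda>x. sep x i j)"
      using mholomorphic_sep[OF that, of UNIV] by (simp add: mholomorphic_def)
    then have "openin (cspace (n - 3)) {x \<in> topspace (cspace (n - 3)). sep x i j \<in> - {0}}"
      by (rule openin_continuous_map_preimage) (simp add: open_Compl)
    then show ?thesis by simp
  qed
  let ?P = "{(i, j) \<in> {1..n} \<times> {1..n}. i \<noteq> j}"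
  have P12: "(1, 2) \<in> ?P" using n4 by auto
  have "openin (cspace (n - 3)) (\<Inter>(i, j)\<in>?P. {x \<in> topspace (cspace (n - 3)). sep x i j \<noteq> 0})"
  proof (rule openin_INT2)
    show "finite ?P" by (rule finite_subset[of _ "{1..n} \<times> {1..n}"]) auto
    show "?P \<noteq> {}" using P12 by blast
  qed (use * in auto)
  also have "(\<Inter>(i, j)\<in>?P. {x \<in> topspace (cspace (n - 3)). sep x i j \<noteq> 0}) = cdom"
  proof (intro equalityI subsetI)
    fix x assume x: "x \<in> (\<Inter>(i, j)\<in>?P. {x \<in> topspace (cspace (n - 3)). sep x i j \<noteq> 0})"
    have "x \<in> topspace (cspace (n - 3))" using x P12 by blast
    moreover have "sep x i j \<noteq> 0" if "i \<in> {1..n}" "j \<in> {1..n}" "i \<noteq> j" for i j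
      using x that by blast
    ultimately show "x \<in> cdom" by (simp add: cdom_def)
  qed (auto simp: cdom_def)
  finally show ?thesis .
qed

lemma sphere_holomorphic_chart:
  assumes q: "q \<in> quads n"
  shows "sphere_holomorphic (n - 3) cdom (\<lambda>x. chart x q)"
proof -
  obtain i j k l where ijkl: "q = (i, j, k, l)" by (cases q)
  have mem: "i \<in> {1..n}" "j \<in> {1..n}" "k \<in> {1..n}" "l \<in> {1..n}" "i \<noteq> j" "i \<noteq> k" "i \<noteq> l" "j \<noteq> k" "j \<noteq> l" "k \<noteq> l"
    using q by (auto simp: ijkl mem_quads)
  have hol: "mholomorphic (n - 3) cdom (\<lambda>x. sepratio x i j k l)"
    "mholomorphic (n - 3) cdom (\<lambda>x. sepratio x j i k l)"
    unfolding sepratio_def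
    by (intro mholomorphic_divide mholomorphic_mult mholomorphic_sep mem no_zero_divisors sep_nz;
        use mem in simp)+
  have hol1: "mholomorphic (n - 3) cdom (\<lambda>x. x 1 * sepratio x i j k l)"
    "mholomorphic (n - 3) cdom (\<lambda>x. x 1 * sepratio x j i k l)"
    by (intro mholomorphic_mult mholomorphic_coord one_coord hol)+
  show ?thesis
    using sphere_holomorphic_Some[OF hol(1)] sphere_holomorphic_Some[OF hol1(1)]
      sphere_holomorphic_sphere_inverse_Some[OF hol1(2)]
    unfolding ijkl chart_apply[OF q[unfolded ijkl]]
    by (cases "i \<in> A"; cases "j \<in> A"; cases "k \<in> A"; cases "l \<in> A") simp_all
qed

lemma continuous_map_chart: "continuous_map (subtopology (cspace (n - 3)) cdom) (cr_space n) chart"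
  unfolding cr_space_def continuous_map_componentwise
  using sphere_holomorphic_chart chart_extensional
  by (auto simp: sphere_holomorphic_def PiE_def)

lemma cdom_subset: "cdom \<subseteq> topspace (cspace (n - 3))"
  by (auto simp: cdom_def)

text \<open>Only \<open>x 1\<close> is moved, within a complex disc. This is the way to leave the
  divisor in a prescribed direction without leaving given neighbourhoods.\<close>

lemma chart_meets_open:
  assumes x: "x \<in> cdom" and W: "openin (cr_space n) W" "chart x \<in> W"
    and V: "openin (cspace (n - 3)) V" "x \<in> V"
  obtains \<delta> where "\<delta> > 0" "\<And>w. dist w (x 1) < \<delta> \<Longrightarrow> x(1 := w) \<in> cdom \<inter> V \<and> chart (x(1 := w)) \<in> W"
proof -
  have "openin (subtopology (cspace (n - 3)) cdom) {y \<in> topspace (subtopology (cspace (n - 3)) cdom). chart y \<in> W}"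
    using continuous_map_chart W(1) by (rule openin_continuous_map_preimage)
  then have "openin (cspace (n - 3)) {y \<in> topspace (subtopology (cspace (n - 3)) cdom). chart y \<in> W}"
    using openin_cdom by (rule openin_trans_full)
  then have "openin (cspace (n - 3)) (V \<inter> {y \<in> topspace (subtopology (cspace (n - 3)) cdom). chart y \<in> W})"
    by (intro openin_Int V)
  moreover have "x \<in> V \<inter> {y \<in> topspace (subtopology (cspace (n - 3)) cdom). chart y \<in> W}"
    using x W V cdom_subset by auto
  ultimately obtain \<delta> where \<delta>: "\<delta> > 0"
    "\<And>w. dist w (x 1) < \<delta> \<Longrightarrow> x(1 := w) \<in> V \<inter> {y \<in> topspace (subtopology (cspace (n - 3)) cdom). chart y \<in> W}"
    using one_coord by (rule openin_cspace_update) blast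
  show thesis
  proof (rule that[OF \<delta>(1)])
    fix w assume "dist w (x 1) < \<delta>"
    from \<delta>(2)[OF this] show "x(1 := w) \<in> cdom \<inter> V \<and> chart (x(1 := w)) \<in> W" by auto
  qed
qed

lemma chart_mem_M0_bar:
  assumes x: "x \<in> cdom"
  shows "chart x \<in> M0_bar n"
  unfolding M0_bar_def in_closure_of
proof (intro conjI allI impI)
  show "chart x \<in> topspace (cr_space n)" using chart_extensional by simp
  fix W assume W: "chart x \<in> W \<and> openin (cr_space n) W"
  obtain \<delta> where \<delta>: "\<delta> > 0" "\<And>w. dist w (x 1) < \<delta> \<Longrightarrow> x(1 := w) \<in> cdom \<inter> cdom \<and> chart (x(1 := w)) \<in> W"
    using chart_meets_open[OF x _ _ openin_cdom x] W by blast
  \<comment> \<open>On the divisor \<open>x 1\<close> is pushed to a small nonzero value; elsewhere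
    the point already lies in the open moduli space.\<close>
  define w where "w = (if x 1 = 0 then of_real (\<delta> / 2) else x 1)"
  have "w \<noteq> 0" "dist w (x 1) < \<delta>"
    using \<delta>(1) by (auto simp: w_def)
  then have "x(1 := w) \<in> cdom" "(x(1 := w)) 1 \<noteq> 0" "chart (x(1 := w)) \<in> W"
    using \<delta>(2) by auto
  then show "\<exists>y. y \<in> M0_open n \<and> y \<in> W"
    using chart_mem_M0_open by blast
qed

section \<open>The inverse of the chart\<close>

definition finite_coords :: "(quad \<Rightarrow> complex option) set" where
  "finite_coords = {p \<in> topspace (cr_space n). \<forall>j\<in>{1..n - 3}. p (coord_quad j) \<in> range Some}"

lemma openin_finite_coords: "openin (cr_space n) finite_coords"
proof -
  have *: "openin (cr_space n) {p \<in> topspace (cr_space n). p (coord_quad j) \<in> range Some}"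
    if "j \<in> {1..n - 3}" for j
    using continuous_map_cr_proj[OF coord_quad_mem[OF that]] openin_riemann_sphere_Some[of UNIV]
    by (intro openin_continuous_map_preimage) auto
  have "openin (cr_space n) (\<Inter>j\<in>{1..n - 3}. {p \<in> topspace (cr_space n). p (coord_quad j) \<in> range Some})"
    using * one_coord by (intro openin_INT2) auto
  also have "(\<Inter>j\<in>{1..n - 3}. {p \<in> topspace (cr_space n). p (coord_quad j) \<in> range Some}) = finite_coords"
    using one_coord by (auto simp: finite_coords_def)
  finally show ?thesis .
qed

lemma continuous_map_readout: "continuous_map (subtopology (cr_space n) finite_coords) (cspace (n - 3)) readout"
  unfolding cspace_def continuous_map_componentwise
proof (intro conjI ballI)
  show "readout ` topspace (subtopology (cr_space n) finite_coords) \<subseteq> extensional {1..n - 3}"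
    by (auto simp: readout_def)
  fix j assume j: "j \<in> {1..n - 3}"
  have "continuous_map (subtopology (cr_space n) finite_coords) riemann_sphere (\<lambda>p. p (coord_quad j))"
    by (intro continuous_map_from_subtopology continuous_map_cr_proj coord_quad_mem j)
  then have "continuous_map (subtopology (cr_space n) finite_coords) (subtopology riemann_sphere (range Some))
      (\<lambda>p. p (coord_quad j))"
    using j by (auto simp: continuous_map_in_subtopology finite_coords_def)
  from continuous_map_compose[OF this continuous_map_the]
  show "continuous_map (subtopology (cr_space n) finite_coords) euclidean (\<lambda>p. readout p j)"
    using j by (simp add: readout_def o_def)
qed

lemma chart_mem_finite_coords: "chart x \<in> finite_coords"
  using chart_extensional by (simp add: finite_coords_def chart_coord_quad)

lemma openin_readout_preimage:
  assumes V: "openin (cspace (n - 3)) V"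
  shows "openin (cr_space n) {p \<in> finite_coords. readout p \<in> V}"
proof -
  have "openin (subtopology (cr_space n) finite_coords)
      {p \<in> topspace (subtopology (cr_space n) finite_coords). readout p \<in> V}"
    using continuous_map_readout V by (rule openin_continuous_map_preimage)
  then have "openin (cr_space n) {p \<in> topspace (subtopology (cr_space n) finite_coords). readout p \<in> V}"
    using openin_finite_coords by (rule openin_trans_full)
  moreover have top: "topspace (subtopology (cr_space n) finite_coords) = finite_coords"
    by (auto simp: finite_coords_def)
  ultimately show ?thesis unfolding top by simp
qed

text \<open>On the open set \<open>O'\<close> both sides are continuous in every cross-ratio and
  agree at the points of the open moduli space. These are dense in the part of the compactification
  inside \<open>O'\<close>, and the sphere is Hausdorff.\<close>

lemma chart_readout:
  assumes p: "p \<in> M0_bar n" "p \<in> finite_coords" "readout p \<in> cdom"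
  shows "chart (readout p) = p"
proof -
  define O' where "O' = {p \<in> finite_coords. readout p \<in> cdom}"
  have O': "openin (cr_space n) O'"
    unfolding O'_def by (rule openin_readout_preimage[OF openin_cdom])
  have pO: "p \<in> O'" using p by (simp add: O'_def)
  have "p \<in> O' \<inter> cr_space n closure_of M0_open n"
    using p(1) pO by (simp add: M0_bar_def)
  then have "p \<in> O' \<inter> cr_space n closure_of (O' \<inter> M0_open n)"
    using openin_Int_closure_of_eq[OF O', of "M0_open n"] by auto
  \<comment> \<open>Taking the closure inside \<open>O'\<close> matters, because
    \<open>chart (readout p)\<close> need not be continuous outside \<open>O'\<close>.\<close>
  then have cl: "p \<in> subtopology (cr_space n) O' closure_of (O' \<inter> M0_open n)"
    by (simp add: closure_of_subtopology_open O')
  have topO: "topspace (subtopology (cr_space n) O') = O'"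
    using openin_subset[OF O'] by auto
  have ro: "continuous_map (subtopology (cr_space n) O') (subtopology (cspace (n - 3)) cdom) readout"
    unfolding continuous_map_in_subtopology
    using continuous_map_from_subtopology_mono[OF continuous_map_readout, of O'] topO
    by (auto simp: O'_def)
  have ext: "p \<in> quads n \<rightarrow>\<^sub>E UNIV" using p(1) M0_bar_subset by auto
  show ?thesis
  proof (rule PiE_ext[OF chart_extensional ext])
    fix q assume q: "q \<in> quads n"
    show "chart (readout p) q = p q"
    proof (rule forall_in_closure_of_eq[OF cl Hausdorff_riemann_sphere])
      have "continuous_map (subtopology (cr_space n) O') (cr_space n) (chart \<circ> readout)"
        using ro continuous_map_chart by (rule continuous_map_compose)
      from continuous_map_compose[OF this continuous_map_cr_proj[OF q]]
      show "continuous_map (subtopology (cr_space n) O') riemann_sphere (\<lambda>p. chart (readout p) q)"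
        by (simp add: o_def)
      show "continuous_map (subtopology (cr_space n) O') riemann_sphere (\<lambda>p. p q)"
        by (intro continuous_map_from_subtopology continuous_map_cr_proj q)
      show "chart (readout y) q = y q" if "y \<in> O' \<inter> M0_open n" for y
        using that readout_cr_embed(4) by (auto simp: M0_open_def)
    qed
  qed
qed

text \<open>Expressing images of the chart as preimages under the continuous map
  \<open>readout\<close> is what makes them open in the compactification.\<close>

lemma chart_image_eq:
  assumes V: "V \<subseteq> cdom"
  shows "chart ` V = M0_bar n \<inter> {p \<in> finite_coords. readout p \<in> V}"
proof (intro equalityI subsetI)
  fix p assume "p \<in> chart ` V"
  then show "p \<in> M0_bar n \<inter> {p \<in> finite_coords. readout p \<in> V}"
    using V chart_mem_M0_bar chart_mem_finite_coords cdom_subset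
    by (auto simp: readout_chart subset_eq)
next
  fix p assume p: "p \<in> M0_bar n \<inter> {p \<in> finite_coords. readout p \<in> V}"
  then have "p = chart (readout p)" using chart_readout V by auto
  then show "p \<in> chart ` V" using p by blast
qed

lemma openin_chart_image:
  assumes "openin (cspace (n - 3)) V" "V \<subseteq> cdom"
  shows "openin (M0_bar_top n) (chart ` V)"
  unfolding chart_image_eq[OF assms(2)] M0_bar_top_def
  using openin_readout_preimage[OF assms(1)] by (rule openin_subtopology_Int2)

lemma homeomorphic_map_chart:
  "homeomorphic_map (subtopology (cspace (n - 3)) cdom) (subtopology (M0_bar_top n) (chart ` cdom)) chart"
proof -
  have top: "subtopology (M0_bar_top n) (chart ` cdom) = subtopology (cr_space n) (chart ` cdom)"
    using chart_mem_M0_bar by (auto simp: M0_bar_top_def subtopology_subtopology intro!: arg_cong[of _ _ "subtopology (cr_space n)"])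
  have "homeomorphic_maps (subtopology (cspace (n - 3)) cdom) (subtopology (cr_space n) (chart ` cdom)) chart readout"
    unfolding homeomorphic_maps_def
  proof (intro conjI ballI)
    show "continuous_map (subtopology (cspace (n - 3)) cdom) (subtopology (cr_space n) (chart ` cdom)) chart"
      using continuous_map_chart by (auto simp: continuous_map_in_subtopology)
    have "continuous_map (subtopology (cr_space n) (chart ` cdom)) (cspace (n - 3)) readout"
      using chart_mem_finite_coords by (intro continuous_map_from_subtopology_mono[OF continuous_map_readout]) auto
    moreover have "readout (chart x) \<in> cdom" if "x \<in> cdom" for x
      using that cdom_subset by (simp add: readout_chart subset_eq)
    ultimately show "continuous_map (subtopology (cr_space n) (chart ` cdom)) (subtopology (cspace (n - 3)) cdom) readout"
      by (auto simp: continuous_map_in_subtopology)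
    show "readout (chart x) = x" if "x \<in> topspace (subtopology (cspace (n - 3)) cdom)" for x
      using that by (simp add: readout_chart)
    show "chart (readout p) = p" if "p \<in> topspace (subtopology (cr_space n) (chart ` cdom))" for p
      using that cdom_subset by (auto simp: readout_chart subset_eq)
  qed
  then show ?thesis unfolding top homeomorphic_map_maps by blast
qed

text \<open>The chosen cross-ratios are the coordinates themselves, so the matrix is the identity;
  this witnesses the immersion condition.\<close>

lemma jacobian_coords: "jacobian (n - 3) (\<lambda>i y. the (chart y (coord_quad i))) x = 1"
proof -
  have "pderiv_at (Suc j) (\<lambda>y. the (chart y (coord_quad (Suc i)))) x = (if i = j then 1 else 0)"
    if "i < n - 3" for i j
    using that by (auto simp: pderiv_at_def chart_coord_quad)
  then have "Matrix.mat (n - 3) (n - 3)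
      (\<lambda>(i, j). pderiv_at (Suc j) (\<lambda>y. the (chart y (coord_quad (Suc i)))) x) = 1\<^sub>m (n - 3)"
    by (intro eq_matI) auto
  then show ?thesis by (simp add: jacobian_def)
qed

lemma holo_param_chart: "holo_param n cdom chart"
  unfolding holo_param_def
proof (intro conjI ballI)
  fix x assume "x \<in> cdom"
  have "jacobian (n - 3) (\<lambda>i y. the (chart y (coord_quad i))) x \<noteq> 0" by (simp add: jacobian_coords)
  then show "\<exists>Q. (\<forall>i\<in>{1..n - 3}. Q i \<in> quads n \<and> chart x (Q i) \<noteq> None) \<and>
        jacobian (n - 3) (\<lambda>i y. the (chart y (Q i))) x \<noteq> 0"
    using coord_quad_mem chart_coord_quad by (intro exI[of _ coord_quad]) auto
qed (use openin_cdom openin_chart_image homeomorphic_map_chart sphere_holomorphic_chart in auto)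

section \<open>The divisor inside the chart\<close>

abbreviation divisor :: "(quad \<Rightarrow> complex option) set" where
  "divisor \<equiv> bdry_divisor n A ({1..n} - A)"

lemma chart_mem_D:
  assumes x: "x \<in> cdom"
  shows "chart x \<in> divisor \<longleftrightarrow> x 1 = 0" and "chart x \<in> M0_open n \<longleftrightarrow> x 1 \<noteq> 0"
proof -
  have not_both: "p \<notin> M0_open n" if "p \<in> divisor" for p
  proof
    assume "p \<in> M0_open n"
    then obtain t where t: "t \<in> M0 n" "p = cr_embed n t" by (auto simp: M0_open_def)
    \<comment> \<open>This single quadruple separates the two sets: its cross-ratio is 1 on the
      divisor and never 1 for distinct points.\<close>
    have "(a0, a1, b0, n) \<in> quads n" using a01 b0 A n_notin_A by (auto simp: mem_quads)
    moreover have "p (a0, a1, b0, n) = Some 1"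
      using that a01 b0 n_notin_A n4 by (auto simp: bdry_divisor_def)
    ultimately show False using cr_embed_neq_1[OF t(1)] t(2) by blast
  qed
  have "chart x \<in> divisor" if x1: "x 1 = 0"
    unfolding bdry_divisor_def
  proof (intro CollectI conjI ballI impI chart_mem_M0_bar x)
    fix i j k l assume ij: "i \<in> A" "j \<in> A" "i \<noteq> j" and kl: "k \<in> {1..n} - A" "l \<in> {1..n} - A" "k \<noteq> l"
    have q: "(i, j, k, l) \<in> quads n" using ij kl A by (auto simp: mem_quads)
    \<comment> \<open>At \<open>x 1 = 0\<close> all cluster points sit at 0, so an outer point
      cannot distinguish \<open>i\<close> from \<open>j\<close>.\<close>
    have eq: "sep x i m = sep x j m" if "m \<in> {1..n} - A" for m
      using ij that x1 n_notin_A by (auto simp: sep_def pos_def)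
    have "sep x i k \<noteq> 0" "sep x i l \<noteq> 0"
      by (rule sep_nz[OF x]; use ij kl A in force)+
    then have "sepratio x i j k l = 1"
      using eq[of k] eq[of l] kl by (simp add: sepratio_def)
    then show "chart x (i, j, k, l) = Some 1"
      using ij by (simp add: chart_apply[OF q])
  qed
  moreover have "chart x \<in> M0_open n" if "x 1 \<noteq> 0" using chart_mem_M0_open[OF x that] .
  ultimately show "chart x \<in> divisor \<longleftrightarrow> x 1 = 0" "chart x \<in> M0_open n \<longleftrightarrow> x 1 \<noteq> 0"
    using not_both by blast+
qed

text \<open>
  The point of the divisor at which \<open>z\<^sub>i = r i\<close> up to separate affine rescalings of the
  cluster and of the remaining points.
\<close>

definition base :: "(nat \<Rightarrow> real) \<Rightarrow> nat \<Rightarrow> complex" where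
  "base r = (\<lambda>j\<in>{1..n - 3}. if j = 1 then 0 else
     let i = the_inv_into free e j
     in of_real ((r i - r a0) / ((if i \<in> A then r a1 else r b0) - r a0)))"

lemma base_1: "base r 1 = 0"
  using one_coord by (simp add: base_def)

lemma loc_base:
  assumes "inj_on r {1..<n}" "i \<in> {1..<n}"
  shows "loc (base r) i = of_real ((r i - r a0) / ((if i \<in> A then r a1 else r b0) - r a0))"
proof -
  have ne: "r a1 \<noteq> r a0" "r b0 \<noteq> r a0"
    using assms(1) a01 b0 A by (auto dest: inj_onD)
  consider "i = a0" | "i = a1" | "i = b0" | "i \<in> free" "i \<noteq> a1" using assms(2) by blast
  then show ?thesis
  proof cases
    case 4
    then have "e i \<noteq> 1" using e_eq_iff[of i a1] a1_free e_a1 by auto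
    then show ?thesis
      using 4 e_range[of i] e by (simp add: loc_free base_def Let_def the_inv_into_f_f bij_betw_def)
  qed (use ne a01 b0 in auto)
qed

lemma base_mem_cdom:
  assumes r: "inj_on r {1..<n}"
  shows "base r \<in> cdom"
  unfolding cdom_def
proof (intro CollectI conjI ballI impI)
  have ne: "r i \<noteq> r j" if "i \<in> {1..<n}" "j \<in> {1..<n}" "i \<noteq> j" for i j
    using r that by (auto dest: inj_onD)
  have lab: "a0 \<in> {1..<n}" "a1 \<in> {1..<n}" "a1 \<noteq> a0" "b0 \<noteq> a0" "b0 \<in> {1..<n}" using a01 b0 A by auto
  fix i j assume ij: "i \<in> {1..n}" "j \<in> {1..n}" "i \<noteq> j"
  show "sep (base r) i j \<noteq> 0"
  proof (cases "i = n \<or> j = n")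
    case False
    then have ij': "i \<in> {1..<n}" "j \<in> {1..<n}" using ij by auto
    show ?thesis
      using False ne[OF ij' ij(3)] ne[of a1 a0] ne[of b0 a0] ne[of i a0] ne[of j a0] lab a01 ij' 
      by (auto simp: sep_def pos_def base_1 loc_base[OF r] simp flip: of_real_diff)
  qed (simp add: sep_def)
qed (simp add: base_def)

lemma adapted_param_chart: "adapted_param n divisor cdom chart"
proof -
  have "\<exists>x\<in>cdom. x 1 = 0"
    using base_mem_cdom[of real] base_1[of real] by (intro bexI[of _ "base real"]) auto
  then show ?thesis
    unfolding adapted_param_def using holo_param_chart chart_mem_D by blast
qed

end

section \<open>The Jacobian determinant\<close>

context bdry_chart
begin

abbreviation scale :: "(nat \<Rightarrow> complex) \<Rightarrow> complex" where
  "scale x \<equiv> pos x (n - 1) - pos x 1"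

lemma pderiv_at_tcoord_chart:
  assumes x: "x \<in> cdom" "x 1 \<noteq> 0" and j: "j \<in> {1..n - 3}"
  shows "pderiv_at j (\<lambda>y. tcoord n (chart y) i) x = pderiv_at j (\<lambda>y. unscaled y i) x"
proof -
  obtain \<delta> where \<delta>: "\<delta> > 0" "\<And>w. dist w (x j) < \<delta> \<Longrightarrow> x(j := w) \<in> cdom"
    using openin_cspace_update[OF openin_cdom x(1) j] by blast
  \<comment> \<open>The bound by the norm of \<open>x 1\<close> keeps the first coordinate nonzero
    even when \<open>j = 1\<close>; there \<open>tcoord\<close> and \<open>unscaled\<close> agree on
    a whole neighbourhood.\<close>
  define \<delta>' where "\<delta>' = min \<delta> (norm (x 1))"
  have "tcoord n (chart (x(j := w))) i = unscaled (x(j := w)) i" if "dist w (x j) < \<delta>'" for w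
  proof -
    have "(x(j := w)) 1 \<noteq> 0"
      using that x(2) by (auto simp: \<delta>'_def)
    then show ?thesis using tcoord_chart[OF \<delta>(2)[of w]] that by (simp add: \<delta>'_def)
  qed
  moreover have "\<delta>' > 0" using \<delta>(1) x(2) by (simp add: \<delta>'_def)
  ultimately have "\<forall>\<^sub>F w in nhds (x j). tcoord n (chart (x(j := w))) i = unscaled (x(j := w)) i"
    unfolding eventually_nhds_metric by blast
  then show ?thesis
    unfolding pderiv_at_def by (rule deriv_cong_ev) simp
qed

text \<open>
  The matrix becomes triangular when row \<open>m\<close> is matched with the column of the label \<open>c m\<close>,
  so only one permutation contributes to the determinant.
\<close>

lemma jacobian_unscaled_eq_prod:
  fixes c :: "nat \<Rightarrow> nat" and r :: "nat \<Rightarrow> nat"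
  assumes c: "bij_betw c {2..n - 2} free"
    and tri: "\<And>x w m k. \<lbrakk>m \<in> {2..n - 2}; k \<in> {2..n - 2}; m \<noteq> k; \<not> r k < r m\<rbrakk>
      \<Longrightarrow> unscaled (x(e (c k) := w)) (m - 1) = unscaled x (m - 1)"
  obtains \<kappa> :: complex where "\<kappa> \<noteq> 0"
    "\<And>x. \<lbrakk>x \<in> cdom; x 1 \<noteq> 0\<rbrakk> \<Longrightarrow> jacobian (n - 3) (\<lambda>i y. tcoord n (chart y) i) x
       = \<kappa> * (\<Prod>m\<in>{2..n - 2}. pderiv_at (e (c m)) (\<lambda>y. unscaled y (m - 1)) x)"
proof -
  \<comment> \<open>Row \<open>i\<close>, counted from 0, belongs to t_(i+1), that is, to the label
    \<open>i + 2\<close>; the columns are shifted by one as well.\<close>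
  define p where "p i = (if i < n - 3 then e (c (i + 2)) - 1 else i)" for i
  have shift: "bij_betw (\<lambda>i. i + 2) {0..<n - 3} {2..n - 2}"
    by (rule bij_betw_byWitness[of _ "\<lambda>i. i - 2"]) (use n4 in auto)
  have shift': "bij_betw (\<lambda>i. i - 1) {1..n - 3} {0..<n - 3}"
    by (rule bij_betw_byWitness[of _ "\<lambda>i. i + 1"]) (use n4 in auto)
  have bij: "bij_betw (\<lambda>i. e (c (i + 2)) - 1) {0..<n - 3} {0..<n - 3}"
    using bij_betw_trans[OF bij_betw_trans[OF bij_betw_trans[OF shift c] e] shift'] by (simp add: o_def)
  have p: "p permutes {0..<n - 3}"
  proof (rule bij_imp_permutes)
    show "bij_betw p {0..<n - 3} {0..<n - 3}"
      using bij by (rule bij_betw_cong[THEN iffD1, rotated]) (simp add: p_def)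
  qed (simp add: p_def)
  have Sucp: "Suc (p i) = e (c (i + 2))" if "i < n - 3" for i
  proof -
    have "i + 2 \<in> {2..n - 2}" using that by auto
    then have "e (c (i + 2)) \<in> {1..n - 3}" by (meson bij_betwE c e_range)
    then show ?thesis using that by (simp add: p_def)
  qed
  show thesis
  proof (rule that)
    show "signof p \<noteq> (0 :: complex)" by (simp add: sign_def)
    fix x assume x: "x \<in> cdom" "x 1 \<noteq> 0"
    define M where "M = Matrix.mat (n - 3) (n - 3) (\<lambda>(i, j). pderiv_at (Suc j) (\<lambda>y. unscaled y (Suc i)) x)"
    have "Matrix.mat (n - 3) (n - 3) (\<lambda>(i, j). pderiv_at (Suc j) (\<lambda>y. tcoord n (chart y) (Suc i)) x) = M"
      unfolding M_def by (intro eq_matI) (simp_all add: pderiv_at_tcoord_chart[OF x])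
    then have "jacobian (n - 3) (\<lambda>i y. tcoord n (chart y) i) x = Determinant.det M"
      by (simp add: jacobian_def)
    also have "\<dots> = signof p * (\<Prod>i = 0..<n - 3. M $$ (i, p i))"
    proof (rule det_rank_triangular[where r = "\<lambda>i. r (i + 2)"])
      show "M \<in> carrier_mat (n - 3) (n - 3)" by (simp add: M_def)
      show "p permutes {0..<n - 3}" by (rule p)
      fix i k assume ik: "i < n - 3" "k < n - 3" "M $$ (i, p k) \<noteq> 0"
      have pk: "p k < n - 3" using permutes_in_image[OF p, of k] ik(2) by simp
      show "i = k \<or> r (k + 2) < r (i + 2)"
      proof (rule ccontr)
        assume "\<not> (i = k \<or> r (k + 2) < r (i + 2))"
        then have "unscaled (x(e (c (k + 2)) := w)) (i + 2 - 1) = unscaled x (i + 2 - 1)" for w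
          using ik by (intro tri) auto
        moreover have "M $$ (i, p k) = pderiv_at (e (c (k + 2))) (\<lambda>y. unscaled y (Suc i)) x"
          using ik pk by (simp add: M_def Sucp)
        ultimately show False using ik(3) by (simp add: pderiv_at_def)
      qed
    qed
    also have "(\<Prod>i = 0..<n - 3. M $$ (i, p i))
        = (\<Prod>i = 0..<n - 3. pderiv_at (e (c (i + 2))) (\<lambda>y. unscaled y (i + 2 - 1)) x)"
    proof (rule prod.cong)
      fix i assume i: "i \<in> {0..<n - 3}"
      then have "p i < n - 3" using permutes_in_image[OF p, of i] by simp
      then show "M $$ (i, p i) = pderiv_at (e (c (i + 2))) (\<lambda>y. unscaled y (i + 2 - 1)) x"
        using i by (simp add: M_def Sucp)
    qed simp
    also have "\<dots> = (\<Prod>m\<in>{2..n - 2}. pderiv_at (e (c m)) (\<lambda>y. unscaled y (m - 1)) x)"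
      by (rule prod.reindex_bij_betw[OF shift])
    finally show "jacobian (n - 3) (\<lambda>i y. tcoord n (chart y) i) x
       = signof p * (\<Prod>m\<in>{2..n - 2}. pderiv_at (e (c m)) (\<lambda>y. unscaled y (m - 1)) x)" .
  qed
qed

section \<open>Entries of the Jacobian matrix\<close>

lemma unscaled_label:
  "m \<in> {2..n - 2} \<Longrightarrow> unscaled x (m - 1) = (pos x m - pos x 1) / scale x"
  by (auto simp: unscaled_def)

lemma loc_update: "k \<in> free \<Longrightarrow> m \<in> {1..<n} \<Longrightarrow> m \<noteq> k \<Longrightarrow> loc (x(e k := w)) m = loc x m"
  using e_eq_iff[of m k] by (auto simp: loc_def)

lemma pos_update:
  assumes "k \<in> free" "k \<noteq> a1" "m \<in> {1..<n}" "m \<noteq> k"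
  shows "pos (x(e k := w)) m = pos x m"
proof -
  have "e k \<noteq> 1" using e_eq_iff[of k a1] a1_free e_a1 assms by auto
  then show ?thesis using loc_update assms by (simp add: pos_def)
qed

lemma pos_update_self:
  assumes "k \<in> free" "k \<noteq> a1"
  shows "pos (x(e k := w)) k = (if k \<in> A then x 1 else 1) * w"
proof -
  have "e k \<noteq> 1" using e_eq_iff[of k a1] a1_free e_a1 assms by auto
  then show ?thesis using assms by (simp add: pos_def loc_free)
qed

lemma pos_update_1: "m \<in> {1..<n} \<Longrightarrow> m \<notin> A \<Longrightarrow> pos (x(1 := w)) m = pos x m"
  using loc_update[OF a1_free, of m] a01 by (auto simp: pos_def e_a1)

text \<open>A label other than \<open>1\<close> and \<open>n - 1\<close> leaves the affine map
  alone, and one other than \<open>a1\<close> does not rescale the cluster, so changing its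
  coordinate moves its own point only.\<close>

lemma unscaled_update:
  assumes "k \<in> free" "k \<noteq> a1" "k \<notin> {1, n - 1}" "m \<in> {2..n - 2}" "m \<noteq> k"
  shows "unscaled (x(e k := w)) (m - 1) = unscaled x (m - 1)"
proof -
  have "1 \<in> {1..<n}" "n - 1 \<in> {1..<n}" "m \<in> {1..<n}" using assms n4 by auto
  then show ?thesis
    using assms pos_update[OF assms(1,2)] by (simp add: unscaled_label)
qed

lemma pderiv_at_unscaled:
  assumes "m \<in> free" "m \<noteq> a1" "m \<in> {2..n - 2}"
  shows "pderiv_at (e m) (\<lambda>y. unscaled y (m - 1)) x = (if m \<in> A - {a0, a1} then x 1 else 1) / scale x"
proof -
  have A: "m \<in> A - {a0, a1} \<longleftrightarrow> m \<in> A" using assms by blast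
  have "1 \<in> {1..<n}" "n - 1 \<in> {1..<n}" "1 \<noteq> m" "n - 1 \<noteq> m" using assms n4 by auto
  then have "unscaled (x(e m := w)) (m - 1) = ((if m \<in> A then x 1 else 1) * w - pos x 1) / scale x" for w
    using assms(3) pos_update[OF assms(1,2)] pos_update_self[OF assms(1,2)] by (simp add: unscaled_label)
  moreover have "((\<lambda>w. (a * w - b) / s) has_field_derivative a / s) (at z)" for a b s z :: complex
    by (auto intro!: derivative_eq_intros simp: divide_inverse)
  ultimately show ?thesis
    unfolding pderiv_at_def A by (simp only: DERIV_imp_deriv)
qed

end

text \<open>
  This choice of \<open>a0, a1, b0\<close> makes the Jacobian matrix triangular up to a permutation.
\<close>

locale bdry_chart_normalized = bdry_chart +
  assumes normalized: "{a0, b0} = {1, n - 1} \<or> a0 = 1 \<and> a1 = n - 1 \<or> b0 = n - 1 \<and> 1 \<notin> A"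
begin

text \<open>In all three normalisations the labels \<open>1\<close> and \<open>n - 1\<close> can lie
  in \<open>A\<close> only as \<open>a0\<close> or \<open>a1\<close>. So the remaining |A| - 2
  cluster labels all index rows and each contributes one factor \<open>t\<close>.\<close>

lemma prod_entries:
  fixes s t :: complex
  shows "(\<Prod>m\<in>{2..n - 2}. (if m \<in> A - {a0, a1} then t else 1) / s) = t ^ (card A - 2) / s ^ (n - 3)"
proof -
  have sub: "A - {a0, a1} \<subseteq> {2..n - 2}"
  proof
    fix m assume m: "m \<in> A - {a0, a1}"
    then have "m \<noteq> 1" "m \<noteq> n - 1" "1 \<le> m" "m < n"
      using normalized A b0 by auto
    then show "m \<in> {2..n - 2}" by auto
  qed
  have "card (A - {a0, a1}) = card A - 2"
    using a01 by (subst card_Diff_subset) auto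
  moreover have "(\<Prod>m\<in>{2..n - 2}. if m \<in> A - {a0, a1} then t else 1) = t ^ card (A - {a0, a1})"
  proof -
    have "{2..n - 2} \<inter> {m. m \<in> A - {a0, a1}} = A - {a0, a1}" using sub by blast
    then show ?thesis by (subst prod.If_cases) (simp_all only: finite_atLeastAtMost prod_constant power_one mult_1_right)
  qed
  moreover have "card {2..n - 2} = n - 3" using n4 by simp
  ultimately show ?thesis by (simp add: prod_dividef)
qed

text \<open>The constant \<kappa> absorbs signs and, when it is constant, one power of
  \<open>scale\<close>. The exponent n - 2 is chosen to match the number of factors in the
  denominator of the cell-form.\<close>

lemma jacobian_tcoord_chart:
  obtains \<kappa> :: complex where "\<kappa> \<noteq> 0"
    "\<And>x. \<lbrakk>x \<in> cdom; x 1 \<noteq> 0\<rbrakk> \<Longrightarrow> jacobian (n - 3) (\<lambda>i y. tcoord n (chart y) i) x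
       = \<kappa> * x 1 ^ (card A - 2) / scale x ^ (n - 2)"
proof -
  note result = that
  let ?f = "\<lambda>x m. (if m \<in> A - {a0, a1} then x 1 else 1) / scale x"
  have n32: "n - 2 = Suc (n - 3)" using n4 by simp
  \<comment> \<open>Common to the two cases in which an anchor \<open>1\<close> or
    \<open>n - 1\<close> moves with a coordinate. That coordinate is matched with the row
    \<open>s\<close> of a label pinned in the chart; the extra factor -1/scale of this entry raises
    the exponent from n - 3 to n - 2.\<close>
  have special: "thesis"
    if c: "bij_betw c {2..n - 2} free"
      and tri: "\<And>x w m k. \<lbrakk>m \<in> {2..n - 2}; k \<in> {2..n - 2}; m \<noteq> k; \<not> r k < r m\<rbrakk>
        \<Longrightarrow> unscaled (x(e (c k) := w)) (m - 1) = unscaled x (m - 1)"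
      and s: "s \<in> {2..n - 2}" "\<And>x. x 1 \<noteq> 0 \<Longrightarrow> x \<in> cdom \<Longrightarrow> pderiv_at (e (c s)) (\<lambda>y. unscaled y (s - 1)) x = ?f x s * (- 1 / scale x)"
      and ord: "\<And>x m. \<lbrakk>m \<in> {2..n - 2}; m \<noteq> s\<rbrakk> \<Longrightarrow> pderiv_at (e (c m)) (\<lambda>y. unscaled y (m - 1)) x = ?f x m"
    for c s and r :: "nat \<Rightarrow> nat"
  proof -
    obtain \<kappa> where \<kappa>: "\<kappa> \<noteq> 0" "\<And>x. \<lbrakk>x \<in> cdom; x 1 \<noteq> 0\<rbrakk> \<Longrightarrow> jacobian (n - 3) (\<lambda>i y. tcoord n (chart y) i) x
       = \<kappa> * (\<Prod>m\<in>{2..n - 2}. pderiv_at (e (c m)) (\<lambda>y. unscaled y (m - 1)) x)"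
      using jacobian_unscaled_eq_prod[OF c tri] by blast
    show thesis
    proof (rule result[of "- \<kappa>"])
      fix x assume x: "x \<in> cdom" "x 1 \<noteq> 0"
      have "(\<Prod>m\<in>{2..n - 2}. pderiv_at (e (c m)) (\<lambda>y. unscaled y (m - 1)) x)
          = (\<Prod>m\<in>{2..n - 2}. ?f x m * (if m = s then - 1 / scale x else 1))"
        using s(2)[OF x(2,1)] ord by (intro prod.cong) auto
      also have "\<dots> = x 1 ^ (card A - 2) / scale x ^ (n - 3) * (- 1 / scale x)"
        using s(1) by (simp only: prod.distrib prod_entries) (simp add: prod.delta)
      finally show "jacobian (n - 3) (\<lambda>i y. tcoord n (chart y) i) x = - \<kappa> * x 1 ^ (card A - 2) / scale x ^ (n - 2)"
        unfolding \<kappa>(2)[OF x] n32 by simp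
    qed (use \<kappa>(1) in simp)
  qed
  \<comment> \<open>In case \<open>one\<close> both anchors are pinned and \<open>scale\<close> is 1
    or -1. In case \<open>two\<close> both lie in the cluster and \<open>scale x = x 1\<close>. In
    case \<open>three\<close> only \<open>n - 1\<close> is pinned and \<open>scale\<close> is 1
    minus the free coordinate of label \<open>1\<close>.\<close>
  consider (one) "{a0, b0} = {1, n - 1}" | (two) "a0 = 1" "a1 = n - 1" | (three) "b0 = n - 1" "1 \<notin> A" "a0 \<noteq> 1"
    using normalized a01 by blast
  then show thesis
  proof cases
    case one
    have free: "free = {2..n - 2}"
      unfolding one using n4 by auto
    obtain k where k: "\<And>x. pos x 1 = k" "\<And>x. pos x (n - 1) = 1 - k" "k \<in> {0, 1}"
    proof (cases "a0 = 1")
      case True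
      then have "b0 = n - 1" using one n4 by (auto simp: doubleton_eq_iff)
      then have "pos x 1 = 0" "pos x (n - 1) = 1" for x
        using pos_a0[of x] pos_b0[of x] unfolding True by auto
      then show thesis by (intro that[of 0]) auto
    next
      case False
      then have "a0 = n - 1" "b0 = 1" using one by (auto simp: doubleton_eq_iff)
      then have "pos x 1 = 1" "pos x (n - 1) = 0" for x
        using pos_a0[of x] pos_b0[of x] by metis+
      then show thesis by (intro that[of 1]) auto
    qed
    have sc: "scale x = scale (\<lambda>_. 0)" "pos x 1 = pos (\<lambda>_. 0) 1" for x
      using k by simp_all
    have nz: "scale (\<lambda>_. 0) \<noteq> 0" using k by auto
    \<comment> \<open>\<open>x 1\<close> rescales the cluster and may enter many rows, any other
      coordinate only its own; hence the lowest rank for \<open>a1\<close>.\<close>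
    define r where "r m = (if m = a1 then 0 else 1 :: nat)" for m
    have c: "bij_betw (\<lambda>m. m) {2..n - 2} free" by (simp add: free bij_betw_def inj_on_def)
    have tri: "unscaled (x(e k := w)) (m - 1) = unscaled x (m - 1)"
      if "m \<in> {2..n - 2}" "k \<in> {2..n - 2}" "m \<noteq> k" "\<not> r k < r m" for x w m k
      using that free by (intro unscaled_update) (auto simp: r_def split: if_splits)
    obtain \<kappa> where \<kappa>: "\<kappa> \<noteq> 0" "\<And>x. \<lbrakk>x \<in> cdom; x 1 \<noteq> 0\<rbrakk> \<Longrightarrow> jacobian (n - 3) (\<lambda>i y. tcoord n (chart y) i) x
       = \<kappa> * (\<Prod>m\<in>{2..n - 2}. pderiv_at (e m) (\<lambda>y. unscaled y (m - 1)) x)"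
      using jacobian_unscaled_eq_prod[OF c tri] by blast
    have entry: "pderiv_at (e m) (\<lambda>y. unscaled y (m - 1)) x = ?f x m" if m: "m \<in> {2..n - 2}" for m x
    proof (cases "m = a1")
      case True
      have "unscaled (x(1 := w)) (a1 - 1) = (w - pos x 1) / scale x" for w
        using m True sc[of "x(1 := w)"] sc[of x] by (simp add: unscaled_label)
      moreover have "((\<lambda>w. (w - b) / s) has_field_derivative 1 / s) (at z)" for b s z :: complex
        by (auto intro!: derivative_eq_intros simp: divide_inverse)
      ultimately show ?thesis
        unfolding pderiv_at_def True e_a1 by (simp add: DERIV_imp_deriv)
    next
      case False
      moreover have "m \<in> free" using m free by blast
      ultimately show ?thesis using m by (intro pderiv_at_unscaled)
    qed
    show thesis
    proof (rule result[of "\<kappa> * scale (\<lambda>_. 0)"])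
      fix x assume x: "x \<in> cdom" "x 1 \<noteq> 0"
      show "jacobian (n - 3) (\<lambda>i y. tcoord n (chart y) i) x
          = \<kappa> * scale (\<lambda>_. 0) * x 1 ^ (card A - 2) / scale x ^ (n - 2)"
      proof -
        have "(\<Prod>m\<in>{2..n - 2}. pderiv_at (e m) (\<lambda>y. unscaled y (m - 1)) x)
            = x 1 ^ (card A - 2) / scale x ^ (n - 3)"
          unfolding prod_entries[symmetric] by (intro prod.cong entry refl)
        moreover have "scale x ^ (n - 2) = scale (\<lambda>_. 0) * scale x ^ (n - 3)"
          unfolding n32 power_Suc by (simp only: sc(1)[of x])
        ultimately show ?thesis using nz unfolding \<kappa>(2)[OF x] by simp
      qed
    qed (use \<kappa>(1) nz in simp)
  next
    case two
    have b0': "b0 \<in> {2..n - 2}" using b0 a01 two by (cases "b0 = 1"; cases "b0 = n - 1") auto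
    have free: "free = {2..n - 1} - {b0}" using two n4 by auto
    \<comment> \<open>The coordinate \<open>x 1\<close> belongs to the anchor \<open>n - 1\<close>,
      which has no row, while the row of \<open>b0\<close> has no coordinate; they are matched. That
      row is 1/(x 1) and involves nothing else, so it gets the lowest rank.\<close>
    define c where "c m = (if m = b0 then n - 1 else m)" for m
    define r where "r m = (if m = b0 then 0 else 1 :: nat)" for m
    show thesis
    proof (rule special[where c = c and r = r and s = b0])
      show "bij_betw c {2..n - 2} free"
        by (rule bij_betw_byWitness[of _ "\<lambda>m. if m = n - 1 then b0 else m"])
          (use b0' n4 in \<open>auto simp: c_def free\<close>)
      show "unscaled (x(e (c k) := w)) (m - 1) = unscaled x (m - 1)"
        if "m \<in> {2..n - 2}" "k \<in> {2..n - 2}" "m \<noteq> k" "\<not> r k < r m" for x w m k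
      proof -
        have "k \<noteq> b0" using that by (auto simp: r_def split: if_splits)
        then have "c k = k" "k \<in> free" "k \<noteq> a1" "k \<notin> {1, n - 1}"
          using that two n4 by (auto simp: c_def free)
        then show ?thesis using unscaled_update that by metis
      qed
      show "b0 \<in> {2..n - 2}" by (rule b0')
      show "pderiv_at (e (c b0)) (\<lambda>y. unscaled y (b0 - 1)) x = ?f x b0 * (- 1 / scale x)"
        if "x 1 \<noteq> 0" "x \<in> cdom" for x
      proof -
        have pos1: "pos y 1 = 0" "pos y (n - 1) = y 1" for y using two pos_a0[of y] pos_a1[of y] by auto
        have "e (c b0) = 1" using e_a1 two by (simp add: c_def)
        moreover have "unscaled y (b0 - 1) = 1 / y 1" for y
          using b0' by (simp add: unscaled_label pos1)
        moreover have "((\<lambda>w. 1 / w) has_field_derivative - 1 / (x 1 * x 1)) (at (x 1))"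
          using that(1) by (auto intro!: derivative_eq_intros)
        ultimately show ?thesis using b0 by (simp add: pderiv_at_def pos1 DERIV_imp_deriv)
      qed
      show "pderiv_at (e (c m)) (\<lambda>y. unscaled y (m - 1)) x = ?f x m"
        if m: "m \<in> {2..n - 2}" "m \<noteq> b0" for x m
      proof -
        have "m \<in> free" unfolding free using m n4 by auto
        moreover have "m \<noteq> a1" "c m = m" using m two n4 by (auto simp: c_def)
        ultimately show ?thesis using pderiv_at_unscaled m by metis
      qed
    qed
  next
    case three
    have a0': "a0 \<in> {2..n - 2}"
    proof -
      have "a0 \<noteq> n - 1" "1 \<le> a0" "a0 < n" using a01 A b0 three by auto
      then show ?thesis using three(3) by auto
    qed
    have free: "free = {1..n - 2} - {a0}" using three n4 by auto
    have ne: "a1 \<noteq> 1" "a1 \<noteq> n - 1" using a01 three b0 by auto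
    \<comment> \<open>The coordinate of label \<open>1\<close> moves an anchor and may enter every
      row; it is matched with the row of \<open>a0\<close>, which depends on it alone because
      \<open>pos x a0 = 0\<close>. Next comes \<open>x 1\<close>, which misses that row; all other
      coordinates enter only their own rows.\<close>
    define c where "c m = (if m = a0 then 1 else m)" for m
    define r where "r m = (if m = a0 then 0 else if m = a1 then 1 else 2 :: nat)" for m
    have posn: "pos y (n - 1) = 1" for y using three pos_b0[of y] by simp
    have pos1: "pos (y(1 := w)) 1 = pos y 1" for y w
      using three n4 by (intro pos_update_1) auto
    have free1: "1 \<in> free" using three n4 by auto
    show thesis
    proof (rule special[where c = c and r = r and s = a0])
      show "bij_betw c {2..n - 2} free"
        by (rule bij_betw_byWitness[of _ "\<lambda>m. if m = 1 then a0 else m"])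
          (use a0' n4 in \<open>auto simp: c_def free\<close>)
      show "unscaled (x(e (c k) := w)) (m - 1) = unscaled x (m - 1)"
        if "m \<in> {2..n - 2}" "k \<in> {2..n - 2}" "m \<noteq> k" "\<not> r k < r m" for x w m k
      proof (cases "k = a1")
        case True
        then have "m = a0" using that a01 by (auto simp: r_def split: if_splits)
        then show ?thesis
          using True a01 a0' by (simp add: c_def e_a1 unscaled_label posn pos1)
      next
        case False
        have "k \<noteq> a0" using that by (auto simp: r_def split: if_splits)
        then have "c k = k" "k \<in> free" "k \<notin> {1, n - 1}"
          using that n4 by (auto simp: c_def free)
        then show ?thesis using unscaled_update that False by metis
      qed
      show "a0 \<in> {2..n - 2}" by (rule a0')
      show "pderiv_at (e (c a0)) (\<lambda>y. unscaled y (a0 - 1)) x = ?f x a0 * (- 1 / scale x)"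
        if "x 1 \<noteq> 0" "x \<in> cdom" for x
      proof -
        have p1: "pos (x(e 1 := w)) 1 = w" for w
          using pos_update_self[OF free1] ne three by simp
        have "pos x 1 = x (e 1)" using loc_free[OF free1] ne three(2) by (simp add: pos_def)
        moreover have "unscaled (x(e 1 := w)) (a0 - 1) = - w / (1 - w)" for w
          using a0' by (simp add: unscaled_label posn p1)
        moreover have "((\<lambda>w. - w / (1 - w)) has_field_derivative - 1 / ((1 - z) * (1 - z))) (at z)"
          if "1 - z \<noteq> 0" for z :: complex
          using that by (auto intro!: derivative_eq_intros simp: field_simps)
        moreover have "1 - pos x 1 \<noteq> 0" using scale_nz[OF that(2,1)] by (simp add: posn)
        ultimately show ?thesis by (simp add: pderiv_at_def c_def posn DERIV_imp_deriv)
      qed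
      show "pderiv_at (e (c m)) (\<lambda>y. unscaled y (m - 1)) x = ?f x m"
        if m: "m \<in> {2..n - 2}" "m \<noteq> a0" for x m
      proof (cases "m = a1")
        case True
        have "unscaled (x(1 := w)) (a1 - 1) = (w - pos x 1) / scale x" for w
          using m True by (simp add: unscaled_label posn pos1)
        moreover have "((\<lambda>w. (w - b) / s) has_field_derivative 1 / s) (at z)" for b s z :: complex
          by (auto intro!: derivative_eq_intros simp: divide_inverse)
        moreover have "e (c m) = 1" using True m e_a1 by (simp add: c_def)
        ultimately show ?thesis
          unfolding pderiv_at_def True by (simp add: DERIV_imp_deriv)
      next
        case False
        have "m \<in> free" unfolding free using m n4 by auto
        moreover have "c m = m" using m by (simp add: c_def)
        ultimately show ?thesis using pderiv_at_unscaled m False by metis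
      qed
    qed
  qed
qed

end

section \<open>Poles and cells\<close>

lemma butlast_rep:
  assumes "distinct (ys @ [n])" "set (ys @ [n]) = {1..n}"
  shows "length ys = n - 1" and "set ys = {1..<n}"
    and "p < n - 1 \<Longrightarrow> ys ! p \<in> {1..<n}"
proof -
  show len: "length ys = n - 1"
    using distinct_card[OF assms(1)] assms(2) by simp
  have "set ys = set (ys @ [n]) - {n}" using assms(1) by auto
  also have "\<dots> = {1..n} - {n}" by (simp only: assms(2))
  also have "\<dots> = {1..<n}" by auto
  finally show set_ys: "set ys = {1..<n}" .
  show "ys ! p \<in> {1..<n}" if "p < n - 1" using that len nth_mem[of p ys] set_ys by simp
qed

context bdry_chart
begin

lemma pos_diff_eq_sep:
  "i \<in> {1..<n} \<Longrightarrow> j \<in> {1..<n} \<Longrightarrow> pos x i - pos x j = (if i \<in> A \<and> j \<in> A then x 1 else 1) * sep x i j"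
  by (auto simp: sep_def pos_def algebra_simps)

text \<open>Each of the n - 2 differences carries one denominator \<open>scale x\<close>, and those
  between two cluster points carry a factor \<open>x 1\<close>.\<close>

lemma cell_form_unscaled:
  assumes ys: "distinct (ys @ [n])" "set (ys @ [n]) = {1..n}" "rep_ending n C = ys @ [n]"
    and x: "x \<in> cdom" "x 1 \<noteq> 0"
  shows "cell_form n C (unscaled x) = scale x ^ (n - 2)
      / (x 1 ^ card (adjacent_in ys A) * (\<Prod>i<n - 2. sep x (ys ! Suc i) (ys ! i)))"
proof -
  note len = butlast_rep(1)[OF ys(1,2)]
  note mem = butlast_rep(3)[OF ys(1,2)]
  let ?P = "\<lambda>i. ys ! Suc i \<in> A \<and> ys ! i \<in> A"
  have "zfin n (unscaled x) ((ys @ [n]) ! Suc i) - zfin n (unscaled x) ((ys @ [n]) ! i)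
      = (if ?P i then x 1 else 1) * sep x (ys ! Suc i) (ys ! i) / scale x" if "i < n - 2" for i
  proof -
    have i: "i < n - 1" "Suc i < n - 1" using that by auto
    show ?thesis
      using i len zfin_unscaled[OF x mem[OF i(1)]] zfin_unscaled[OF x mem[OF i(2)]]
        pos_diff_eq_sep[OF mem[OF i(2)] mem[OF i(1)], of x]
      by (simp add: nth_append diff_divide_distrib[symmetric])
  qed
  then have "(\<Prod>i<n - 2. zfin n (unscaled x) ((ys @ [n]) ! Suc i) - zfin n (unscaled x) ((ys @ [n]) ! i))
      = (\<Prod>i<n - 2. (if ?P i then x 1 else 1) * sep x (ys ! Suc i) (ys ! i) / scale x)"
    by (intro prod.cong) auto
  also have "\<dots> = (\<Prod>i<n - 2. if ?P i then x 1 else 1) * (\<Prod>i<n - 2. sep x (ys ! Suc i) (ys ! i)) / scale x ^ (n - 2)"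
    by (simp add: prod_dividef prod.distrib)
  also have "(\<Prod>i<n - 2. if ?P i then x 1 else 1) = x 1 ^ card ({..<n - 2} \<inter> {i. ?P i})"
    by (subst prod.If_cases) simp_all
  also have "{..<n - 2} \<inter> {i. ?P i} = adjacent_in ys A"
    using len n4 by (auto simp: adjacent_in_def)
  finally show ?thesis
    unfolding cell_form_def ys(3) Let_def by simp
qed

end

context bdry_chart_normalized
begin

lemma form_order_cell_form:
  assumes ys: "distinct (ys @ [n])" "set (ys @ [n]) = {1..n}" "rep_ending n C = ys @ [n]"
  shows "form_order n (cell_form n C) divisor (int (card A) - 2 - int (card (adjacent_in ys A)))"
proof -
  obtain \<kappa> where \<kappa>: "\<kappa> \<noteq> 0"
    "\<And>x. \<lbrakk>x \<in> cdom; x 1 \<noteq> 0\<rbrakk> \<Longrightarrow> jacobian (n - 3) (\<lambda>i y. tcoord n (chart y) i) x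
       = \<kappa> * x 1 ^ (card A - 2) / scale x ^ (n - 2)"
    using jacobian_tcoord_chart by blast
  note len = butlast_rep(1)[OF ys(1,2)]
  have mem: "ys ! i \<in> {1..n}" "ys ! Suc i \<in> {1..n}" "ys ! Suc i \<noteq> ys ! i" if "i < n - 2" for i
  proof -
    have i: "i < length ys" "Suc i < length ys" using that len by auto
    then show "ys ! i \<in> {1..n}" "ys ! Suc i \<in> {1..n}"
      using butlast_rep(3)[OF ys(1,2)] len by (simp_all add: less_imp_le)
    show "ys ! Suc i \<noteq> ys ! i"
      using ys(1) i by (simp add: nth_eq_iff_index_eq)
  qed
  have "finite A" using A by (rule finite_subset) simp
  then have cardA: "2 \<le> card A" using card_mono[of A "{a0, a1}"] a01 by simp
  define P where "P x = (\<Prod>i<n - 2. sep x (ys ! Suc i) (ys ! i))" for x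
  have Pnz: "P x \<noteq> 0" if "x \<in> cdom" for x
    unfolding P_def using mem sep_nz[OF that] by auto
  \<comment> \<open>Because \<open>sep\<close> has the vanishing factors removed, \<open>P\<close>
    is nonzero at \<open>x 1 = 0\<close> too, so this quotient is the required unit.\<close>
  have "mholomorphic (n - 3) cdom (\<lambda>x. \<kappa> / P x)"
    unfolding P_def using Pnz[unfolded P_def] mem
    by (intro mholomorphic_divide mholomorphic_const mholomorphic_prod mholomorphic_sep) auto
  moreover have "\<kappa> / P x \<noteq> 0" if "x \<in> cdom" for x
    using \<kappa>(1) Pnz[OF that] by simp
  moreover have "pullback_coeff n (cell_form n C) chart x
      = x 1 powi (int (card A) - 2 - int (card (adjacent_in ys A))) * (\<kappa> / P x)"
    if x: "x \<in> cdom" "x 1 \<noteq> 0" for x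
  proof -
    have "int (card A) - 2 - int (card (adjacent_in ys A)) = int (card A - 2) - int (card (adjacent_in ys A))"
      using cardA by simp
    then have "x 1 powi (int (card A) - 2 - int (card (adjacent_in ys A)))
        = x 1 ^ (card A - 2) / x 1 ^ card (adjacent_in ys A)"
      using x(2) power_int_diff[of "x 1" "int (card A - 2)" "int (card (adjacent_in ys A))"]
      by (simp only: power_int_of_nat) blast
    then show ?thesis
      unfolding pullback_coeff_def tcoord_chart[OF x] cell_form_unscaled[OF ys x] \<kappa>(2)[OF x] P_def
      using scale_nz[OF x] by simp
  qed
  ultimately show ?thesis
    unfolding form_order_def using adapted_param_chart by blast
qed

end

section \<open>Which divisors bound the cell\<close>

lemma zfin_real:
  assumes "\<forall>i\<in>{1..n - 3}. t i \<in> \<real>" "i \<in> {1..<n}"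
  shows "zfin n t i \<in> \<real>"
proof (cases "i = 1 \<or> i = n - 1")
  case False
  then have "i - 1 \<in> {1..n - 3}" using assms(2) by auto
  then show ?thesis using False assms(1) by (simp add: zfin_def)
qed (auto simp: zfin_def)

lemma sorted_wrt_map_rev:
  "sorted_wrt (<) (map f (rev xs)) \<longleftrightarrow> sorted_wrt (\<lambda>a b. f b < f a) (xs :: 'a list)" for f :: "'a \<Rightarrow> real"
  by (simp add: sorted_wrt_map sorted_wrt_rev)

context bdry_chart
begin

text \<open>The argument shows more: no point of the divisor lies in the closure of the cell,
  whatever the dimension of the intersection.\<close>

lemma not_consecutive_imp_not_bounds_cell:
  assumes ys: "distinct (ys @ [n])" "set (ys @ [n]) = {1..n}"
    and E: "\<And>xs. xs \<in> E \<and> last xs = n \<Longrightarrow> xs = ys @ [n] \<or> xs = rev ys @ [n]"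
    and not: "\<not> consecutive_in ys A"
  shows "\<not> bounds_cell n E divisor"
proof
  assume "bounds_cell n E divisor"
  then obtain W p where W: "openin (M0_bar_top n) W" "W \<inter> divisor \<inter> M0_bar_real n \<subseteq> M0_bar_top n closure_of cell n E"
    and p: "p \<in> W \<inter> divisor \<inter> M0_bar_real n"
    unfolding bounds_cell_def by blast
  note len = butlast_rep(1)[OF ys(1,2)]
  obtain i j k where ijk: "i < j" "j < k" "k < length ys" "ys ! i \<in> A" "ys ! k \<in> A" "ys ! j \<notin> A"
    using not unfolding consecutive_in_def by blast
  define a b c where abc: "a = ys ! i" "b = ys ! j" "c = ys ! k"
  have mem: "a \<in> {1..<n}" "b \<in> {1..<n}" "c \<in> {1..<n}"
    unfolding abc by (rule butlast_rep(3)[OF ys]; use ijk len in simp)+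
  have "distinct [a, b, c]"
    using ijk ys(1) by (simp add: abc nth_eq_iff_index_eq)
  then have q: "(a, c, b, n) \<in> quads n" using mem by (auto simp: mem_quads)
  have p1: "p (a, c, b, n) = Some 1"
    using p ijk \<open>distinct [a, b, c]\<close> mem n_notin_A by (auto simp: bdry_divisor_def abc)
  \<comment> \<open>The half-plane Re w > 0 gives a neighbourhood of the value 1 that contains no
    negative number.\<close>
  define T where "T = {p \<in> topspace (M0_bar_top n). p (a, c, b, n) \<in> Some ` {w. Re w > 0}}"
  have "openin (M0_bar_top n) T"
    unfolding T_def M0_bar_top_def
    using continuous_map_cr_proj[OF q] openin_riemann_sphere_Some[OF open_halfspace_Re_gt[of 0]]
    by (intro openin_continuous_map_preimage continuous_map_from_subtopology)
  moreover have "p \<in> M0_bar_top n closure_of cell n E" using p W by blast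
  moreover from this have "p \<in> T"
    using p1 by (auto simp: T_def in_closure_of)
  ultimately obtain y where y: "y \<in> cell n E" "y \<in> T"
    unfolding in_closure_of by blast
  then obtain t xs where t: "t \<in> M0 n" "\<forall>i\<in>{1..n - 3}. t i \<in> \<real>" "y = cr_embed n t"
    and xs: "xs \<in> E" "last xs = n" "sorted_wrt (<) (map (\<lambda>i. Re (zfin n t i)) (butlast xs))"
    unfolding cell_def by blast
  define z where "z i = Re (zfin n t i)" for i
  have zfin: "zfin n t i = of_real (z i)" if "i \<in> {1..<n}" for i
    using zfin_real[OF t(2) that] by (simp add: z_def)
  have "y (a, c, b, n) = Some ((zfin n t a - zfin n t b) / (zfin n t c - zfin n t b))"
    using q mem by (simp add: t(3) cr_embed_apply cross_ratio_def sphere_diff_mark)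
  also have "\<dots> = Some (of_real ((z a - z b) / (z c - z b)))"
    by (simp only: zfin[OF mem(1)] zfin[OF mem(2)] zfin[OF mem(3)] of_real_diff of_real_divide)
  finally have pos: "(z a - z b) / (z c - z b) > 0"
    using y(2) by (auto simp: T_def)
  have "xs = ys @ [n] \<or> xs = rev ys @ [n]" using E xs by blast
  then have "(z a < z b \<and> z b < z c) \<or> (z b < z a \<and> z c < z b)"
  proof
    assume "xs = ys @ [n]"
    then have "sorted_wrt (\<lambda>a b. z a < z b) ys"
      using xs(3) by (simp add: sorted_wrt_map z_def)
    then show ?thesis using ijk unfolding abc by (simp add: sorted_wrt_iff_nth_less)
  next
    assume "xs = rev ys @ [n]"
    then have "sorted_wrt (\<lambda>a b. z b < z a) ys"
      using xs(3) by (simp add: sorted_wrt_map_rev z_def butlast_append del: rev_map map_append)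
    then show ?thesis using ijk unfolding abc by (simp add: sorted_wrt_iff_nth_less)
  qed
  then show False using pos by (auto simp: zero_less_divide_iff)
qed

lemma sep_real:
  assumes "\<forall>j\<in>{1..n - 3}. x j \<in> \<real>" "i \<in> {1..n}" "j \<in> {1..n}"
  shows "sep x i j \<in> \<real>"
proof -
  have "loc x i \<in> \<real>" if "i \<in> {1..<n}" for i
    using assms(1) e_range[of i] that by (auto simp: loc_def)
  moreover from this have "pos x i \<in> \<real>" if "i \<in> {1..<n}" for i
    using assms(1) one_coord that by (auto simp: pos_def)
  ultimately show ?thesis using assms(2,3) by (auto simp: sep_def)
qed

lemma chart_mem_M0_bar_real:
  assumes x: "x \<in> cdom" "\<forall>j\<in>{1..n - 3}. x j \<in> \<real>"
  shows "chart x \<in> M0_bar_real n"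
  unfolding M0_bar_real_def
proof (intro CollectI conjI ballI chart_mem_M0_bar x(1))
  fix q assume q: "q \<in> quads n"
  obtain i j k l where ijkl: "q = (i, j, k, l)" by (cases q)
  have "sepratio x i j k l \<in> \<real>" "sepratio x j i k l \<in> \<real>" "x 1 \<in> \<real>"
    using q x(2) one_coord sep_real[OF x(2)] unfolding ijkl mem_quads sepratio_def
    by (auto intro!: Reals_divide Reals_mult)
  then show "chart x q \<in> insert None (Some ` \<real>)"
    using q unfolding ijkl by (auto simp: chart_apply sphere_inverse_def intro!: Reals_mult Reals_inverse)
qed

lemma consecutive_imp_bounds_cell:
  assumes ys: "distinct (ys @ [n])" "set (ys @ [n]) = {1..n}"
    and E: "ys @ [n] \<in> E" "rev ys @ [n] \<in> E"
    and cons: "consecutive_in ys A"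
  shows "bounds_cell n E divisor"
proof -
  note len = butlast_rep(1)[OF ys(1,2)]
  note set_ys = butlast_rep(2)[OF ys]
  note memy = butlast_rep(3)[OF ys]
  \<comment> \<open>Each label is placed at its index in \<open>ys\<close>, so \<open>base r\<close>
    is a point of the divisor obtained from a configuration in the right order.\<close>
  define r where "r i = real (inv_into {..<n - 1} ((!) ys) i)" for i
  have inj: "inj_on ((!) ys) {..<n - 1}"
    using ys(1) len by (auto simp: inj_on_def nth_eq_iff_index_eq)
  have r: "r (ys ! p) = real p" if "p < n - 1" for p
    using inv_into_f_f[OF inj, of p] that by (simp add: r_def)
  have surj: "\<exists>p<n - 1. i = ys ! p" if "i \<in> {1..<n}" for i
    using that len set_ys by (metis in_set_conv_nth)
  have inj_r: "inj_on r {1..<n}"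
    by (rule inj_onI) (metis r surj of_nat_eq_iff)
  have lab: "a0 \<in> {1..<n}" "a1 \<in> {1..<n}" "a1 \<noteq> a0" "b0 \<noteq> a0" "b0 \<in> {1..<n}" using a01 b0 A by auto
  \<comment> \<open>Their signs record whether sending \<open>a1\<close> (inside the cluster) and
    \<open>b0\<close> (outside) to 1 preserves or reverses the order of \<open>ys\<close>.\<close>
  define \<alpha> \<beta> where ab: "\<alpha> = r a1 - r a0" "\<beta> = r b0 - r a0"
  have ab_nz: "\<alpha> \<noteq> 0" "\<beta> \<noteq> 0"
    using inj_r lab unfolding ab by (auto dest: inj_onD)
  define coef where "coef p q = (if ys ! p \<in> A \<and> ys ! q \<in> A then \<alpha> else \<beta>)" for p q
  let ?I = "{(p, q). p < q \<and> q < n - 1}"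
  \<comment> \<open>An open condition at the divisor: all separations have the sign prescribed by
    \<open>ys\<close>, measured by \<alpha> inside the cluster and by \<beta> otherwise.\<close>
  define V where "V = {x \<in> cdom. \<forall>p q. p < q \<longrightarrow> q < n - 1 \<longrightarrow> 0 < coef p q * Re (sep x (ys ! q) (ys ! p))}"
  have opn: "openin (cspace (n - 3)) {x \<in> topspace (cspace (n - 3)). 0 < a * Re (sep x i j)}"
    if "i \<in> {1..n}" "j \<in> {1..n}" for a i j
  proof -
    have "continuous_map (cspace (n - 3)) euclidean (\<lambda>x. of_real a * sep x i j)"
      using mholomorphic_mult[OF mholomorphic_const[of _ UNIV "of_real a"] mholomorphic_sep[OF that]]
      by (simp add: mholomorphic_def)
    then have "openin (cspace (n - 3)) {x \<in> topspace (cspace (n - 3)). of_real a * sep x i j \<in> {w. Re w > 0}}"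
      by (rule openin_continuous_map_preimage) (simp add: open_halfspace_Re_gt)
    then show ?thesis by simp
  qed
  have "openin (cspace (n - 3)) (\<Inter>(p, q)\<in>?I. {x \<in> topspace (cspace (n - 3)). 0 < coef p q * Re (sep x (ys ! q) (ys ! p))})"
  proof (rule openin_INT2)
    show "finite ?I" by (rule finite_subset[of _ "{..<n - 1} \<times> {..<n - 1}"]) auto
    have "(0, 1) \<in> ?I" using n4 by simp
    then show "?I \<noteq> {}" by blast
    show "openin (cspace (n - 3)) (case s of (p, q) \<Rightarrow>
        {x \<in> topspace (cspace (n - 3)). 0 < coef p q * Re (sep x (ys ! q) (ys ! p))})" if s: "s \<in> ?I" for s
    proof -
      obtain p q where pq: "s = (p, q)" "p < q" "q < n - 1" using s by auto
      have "ys ! p \<in> {1..n}" "ys ! q \<in> {1..n}" using memy[of p] memy[of q] pq by auto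
      then show ?thesis using opn by (simp add: pq(1))
    qed
  qed
  then have "openin (cspace (n - 3)) (cdom \<inter> (\<Inter>(p, q)\<in>?I. {x \<in> topspace (cspace (n - 3)). 0 < coef p q * Re (sep x (ys ! q) (ys ! p))}))"
    by (rule openin_Int[OF openin_cdom])
  also have "cdom \<inter> (\<Inter>(p, q)\<in>?I. {x \<in> topspace (cspace (n - 3)). 0 < coef p q * Re (sep x (ys ! q) (ys ! p))}) = V"
  proof (intro equalityI subsetI)
    fix x assume "x \<in> V"
    then show "x \<in> cdom \<inter> (\<Inter>(p, q)\<in>?I. {x \<in> topspace (cspace (n - 3)). 0 < coef p q * Re (sep x (ys ! q) (ys ! p))})"
      using cdom_subset unfolding V_def by blast
  next
    fix x assume x: "x \<in> cdom \<inter> (\<Inter>(p, q)\<in>?I. {x \<in> topspace (cspace (n - 3)). 0 < coef p q * Re (sep x (ys ! q) (ys ! p))})"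
    then have "0 < coef p q * Re (sep x (ys ! q) (ys ! p))" if "p < q" "q < n - 1" for p q
      using that by blast
    then show "x \<in> V" using x unfolding V_def by blast
  qed
  finally have Vopen: "openin (cspace (n - 3)) V" .
  have Vsub: "V \<subseteq> cdom" by (auto simp: V_def)

  have baseV: "base r \<in> V"
    unfolding V_def
  proof (intro CollectI conjI allI impI base_mem_cdom inj_r)
    fix p q assume pq: "p < q" "q < n - 1"
    then have pq': "p < n - 1" by simp
    let ?i = "ys ! p" and ?j = "ys ! q"
    have ne: "?i \<noteq> n" "?j \<noteq> n" using memy[OF pq'] memy[OF pq(2)] by auto
    obtain p0 where p0: "p0 < n - 1" "a0 = ys ! p0" using surj lab by blast
    have ra0: "r a0 = real p0" unfolding p0(2) by (rule r[OF p0(1)])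
    have lq: "loc (base r) ?j = of_real ((real q - r a0) / (if ?j \<in> A then \<alpha> else \<beta>))"
      and lp: "loc (base r) ?i = of_real ((real p - r a0) / (if ?i \<in> A then \<alpha> else \<beta>))"
      using loc_base[OF inj_r memy[OF pq']] loc_base[OF inj_r memy[OF pq(2)]] pq pq'
      by (simp_all add: r ab)
    show "0 < coef p q * Re (sep (base r) ?j ?i)"
    proof (cases "?i \<in> A")
      case True
      show ?thesis
      proof (cases "?j \<in> A")
        case True
        have "Re (sep (base r) ?j ?i) = (real q - real p) / \<alpha>"
          using True \<open>?i \<in> A\<close> ne by (simp add: sep_def lq lp diff_divide_distrib)
        then show ?thesis using True \<open>?i \<in> A\<close> pq ab_nz by (simp add: coef_def)
      next
        case False
        \<comment> \<open>Seen from outside, the cluster sits at \<open>a0\<close>. Consecutiveness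
          puts all of \<open>A\<close> on the same side of an outer label, so \<open>a0\<close> may
          stand in for \<open>?i\<close>.\<close>
        have "p0 < q"
        proof (rule ccontr)
          assume "\<not> p0 < q"
          moreover have "p0 \<noteq> q" using p0 False a01 by auto
          ultimately have "q < p0" by simp
          then show False
            using cons \<open>?i \<in> A\<close> False pq p0 a01 len unfolding consecutive_in_def by metis
        qed
        moreover have "Re (sep (base r) ?j ?i) = (real q - real p0) / \<beta>"
          using False \<open>?i \<in> A\<close> ne by (simp add: sep_def pos_def base_1 lq ra0)
        ultimately show ?thesis using False ab_nz by (simp add: coef_def)
      qed
    next
      case False
      show ?thesis
      proof (cases "?j \<in> A")
        case True
        have "p < p0"
        proof (rule ccontr)
          assume "\<not> p < p0"
          moreover have "p0 \<noteq> p" using p0 False a01 by auto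
          ultimately have "p0 < p" by simp
          then show False
            using cons \<open>?j \<in> A\<close> False pq p0 a01 len unfolding consecutive_in_def by metis
        qed
        moreover have "Re (sep (base r) ?j ?i) = (real p0 - real p) / \<beta>"
          using False True ne minus_divide_left[of "real p - real p0" \<beta>]
          by (simp add: sep_def pos_def base_1 lp ra0 del: minus_divide_left)
        ultimately show ?thesis using False ab_nz by (simp add: coef_def)
      next
        case jA: False
        have "Re (sep (base r) ?j ?i) = (real q - real p) / \<beta>"
          using False jA ne by (simp add: sep_def pos_def lq lp diff_divide_distrib)
        then show ?thesis using False pq ab_nz by (simp add: coef_def)
      qed
    qed
  qed

  have near: "chart x \<in> M0_bar_top n closure_of cell n E"
    if x: "x \<in> V" "x 1 = 0" "\<forall>j\<in>{1..n - 3}. x j \<in> \<real>" for x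
    unfolding in_closure_of
  proof (intro conjI allI impI)
    have xd: "x \<in> cdom" using x(1) Vsub by blast
    show "chart x \<in> topspace (M0_bar_top n)"
      using chart_mem_M0_bar[OF xd] M0_bar_subset by (auto simp: M0_bar_top_def)
    fix T assume T: "chart x \<in> T \<and> openin (M0_bar_top n) T"
    then obtain T' where T': "openin (cr_space n) T'" "T = T' \<inter> M0_bar n"
      by (auto simp: M0_bar_top_def openin_subtopology)
    obtain \<delta> where \<delta>: "\<delta> > 0" "\<And>w. dist w (x 1) < \<delta> \<Longrightarrow> x(1 := w) \<in> cdom \<inter> V \<and> chart (x(1 := w)) \<in> T'"
      using chart_meets_open[OF xd T'(1) _ Vopen x(1)] T T'(2) by blast
    \<comment> \<open>With this sign, multiplying the cluster separations by \<epsilon> turns their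
      orientation \<alpha> into \<beta>; after that all pairs are ordered consistently.\<close>
    define \<epsilon> where "\<epsilon> = sgn (\<alpha> * \<beta>) * (\<delta> / 2)"
    define x' where "x' = x(1 := of_real \<epsilon>)"
    have eps: "\<epsilon> \<noteq> 0" "\<bar>\<epsilon>\<bar> < \<delta>" "0 < \<beta> * \<epsilon> / \<alpha>"
      using ab_nz \<delta>(1)
      by (auto simp: \<epsilon>_def sgn_if zero_less_mult_iff zero_less_divide_iff divide_less_0_iff mult_less_0_iff
          linorder_neq_iff split: if_splits)
    have "dist (of_real \<epsilon>) (x 1) < \<delta>" using eps(2) x(2) by simp
    then have x'V: "x' \<in> V" and x'T: "chart x' \<in> T'" using \<delta>(2) by (auto simp: x'_def)
    have x'd: "x' \<in> cdom" using x'V Vsub by blast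
    have x'1: "x' 1 = of_real \<epsilon>" "x' 1 \<noteq> 0" using eps(1) by (simp_all add: x'_def)
    have x'real: "\<forall>j\<in>{1..n - 3}. x' j \<in> \<real>" using x(3) by (simp add: x'_def)
    have mono: "0 < \<beta> * Re (pos x' (ys ! q) - pos x' (ys ! p))" if pq: "p < q" "q < n - 1" for p q
    proof -
      have c: "0 < coef p q * Re (sep x' (ys ! q) (ys ! p))"
        using x'V pq by (simp add: V_def)
      have "pos x' (ys ! q) - pos x' (ys ! p)
          = (if ys ! q \<in> A \<and> ys ! p \<in> A then x' 1 else 1) * sep x' (ys ! q) (ys ! p)"
        using pq by (intro pos_diff_eq_sep memy) auto
      moreover have "0 < \<beta> * (\<epsilon> * s)" if "0 < \<alpha> * s" for s
      proof -
        have "0 < (\<beta> * \<epsilon> / \<alpha>) * (\<alpha> * s)" by (rule mult_pos_pos[OF eps(3) that])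
        also have "\<dots> = \<beta> * (\<epsilon> * s)" using ab_nz(1) by simp
        finally show ?thesis .
      qed
      ultimately show ?thesis using c by (auto simp: coef_def x'1(1))
    qed
    define s where "s = Re (scale x')"
    have pos_real: "pos x' i = of_real (Re (pos x' i))" if "i \<in> {1..<n}" for i
    proof -
      have "pos x' i - pos x' a0 = (if i \<in> A \<and> a0 \<in> A then x' 1 else 1) * sep x' i a0"
        using that lab by (intro pos_diff_eq_sep) auto
      moreover have "sep x' i a0 \<in> \<real>" using that lab by (intro sep_real x'real) auto
      ultimately have "pos x' i \<in> \<real>" by (simp add: x'1(1))
      then show ?thesis by simp
    qed
    have "1 \<in> {1..<n}" "n - 1 \<in> {1..<n}" using n4 by auto
    then have "pos x' 1 = of_real (Re (pos x' 1))" "pos x' (n - 1) = of_real (Re (pos x' (n - 1)))"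
      using pos_real by blast+
    then have "Im (pos x' 1) = 0" "Im (pos x' (n - 1)) = 0" by (metis Im_complex_of_real)+
    then have sc: "scale x' = of_real s" by (simp add: s_def complex_eq_iff)
    then have s: "s \<noteq> 0" using scale_nz[OF x'd x'1(2)] by (metis of_real_0)
    have zre: "zfin n (unscaled x') i = of_real ((Re (pos x' i) - Re (pos x' 1)) / s)" if "i \<in> {1..<n}" for i
    proof -
      have "pos x' i - pos x' 1 = of_real (Re (pos x' i) - Re (pos x' 1))"
        using pos_real[OF that] \<open>pos x' 1 = of_real (Re (pos x' 1))\<close> by (metis of_real_diff)
      then show ?thesis unfolding zfin_unscaled[OF x'd x'1(2) that] sc by simp
    qed
    have step: "0 < (\<beta> * s) * (Re (zfin n (unscaled x') (ys ! q)) - Re (zfin n (unscaled x') (ys ! p)))"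
      if pq: "p < q" "q < n - 1" for p q
    proof -
      have "ys ! p \<in> {1..<n}" "ys ! q \<in> {1..<n}" using pq by (auto intro!: memy simp del: atLeastLessThan_iff)
      then have eq: "(\<beta> * s) * (Re (zfin n (unscaled x') (ys ! q)) - Re (zfin n (unscaled x') (ys ! p)))
          = \<beta> * Re (pos x' (ys ! q) - pos x' (ys ! p))"
        using s by (simp add: zre diff_divide_distrib[symmetric])
      show ?thesis unfolding eq by (rule mono[OF pq])
    qed
    have "\<exists>xs\<in>E. last xs = n \<and> sorted_wrt (<) (map (\<lambda>i. Re (zfin n (unscaled x') i)) (butlast xs))"
    \<comment> \<open>The affine map back to the t_i may reverse the line; the sign of \<beta> s
      decides between \<open>ys\<close> and its reversal, both of which represent the dihedral
      structure.\<close>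
    proof (cases "0 < \<beta> * s")
      case True
      have "Re (zfin n (unscaled x') (ys ! p)) < Re (zfin n (unscaled x') (ys ! q))" if "p < q" "q < n - 1" for p q
        using zero_less_mult_pos[OF step[OF that] True] by simp
      then have "sorted_wrt (<) (map (\<lambda>i. Re (zfin n (unscaled x') i)) ys)"
        using len by (simp add: sorted_wrt_iff_nth_less)
      then show ?thesis using E(1) by (intro bexI[of _ "ys @ [n]"]) auto
    next
      case False
      have neg: "b < 0" if "0 < a * b" "\<not> 0 < a" for a b :: real
        using that by (auto simp: zero_less_mult_iff)
      have "Re (zfin n (unscaled x') (ys ! q)) < Re (zfin n (unscaled x') (ys ! p))" if "p < q" "q < n - 1" for p q
        using neg[OF step[OF that] False] by simp
      then have "sorted_wrt (\<lambda>a b. Re (zfin n (unscaled x') b) < Re (zfin n (unscaled x') a)) ys"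
        using len by (simp add: sorted_wrt_iff_nth_less)
      then have "sorted_wrt (<) (map (\<lambda>i. Re (zfin n (unscaled x') i)) (rev ys))"
        by (simp only: sorted_wrt_map_rev)
      then show ?thesis using E(2) by (intro bexI[of _ "rev ys @ [n]"]) (auto simp: butlast_append)
    qed
    moreover have "unscaled x' i \<in> \<real>" if "i \<in> {1..n - 3}" for i
    proof -
      have "zfin n (unscaled x') (Suc i) = unscaled x' i" "Suc i \<in> {1..<n}"
        using that by (auto simp: zfin_def)
      then show ?thesis using zre[of "Suc i"] by simp
    qed
    ultimately have "chart x' \<in> cell n E"
      unfolding cell_def chart_eq_cr_embed[OF x'd x'1(2)]
      using unscaled_mem_M0[OF x'd x'1(2)] by blast
    then show "\<exists>y. y \<in> cell n E \<and> y \<in> T"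
      using x'T T'(2) chart_mem_M0_bar[OF x'd] by blast
  qed

  show ?thesis
    unfolding bounds_cell_def
  proof (intro exI[of _ "chart ` V"] conjI)
    show "openin (M0_bar_top n) (chart ` V)" by (rule openin_chart_image[OF Vopen Vsub])
    have "\<forall>j\<in>{1..n - 3}. base r j \<in> \<real>" by (simp add: base_def Let_def)
    then have "chart (base r) \<in> chart ` V \<inter> divisor \<inter> M0_bar_real n"
      using baseV chart_mem_D(1)[OF base_mem_cdom[OF inj_r]] chart_mem_M0_bar_real[OF base_mem_cdom[OF inj_r]] base_1
      by blast
    then show "chart ` V \<inter> divisor \<inter> M0_bar_real n \<noteq> {}" by blast
    show "chart ` V \<inter> divisor \<inter> M0_bar_real n \<subseteq> M0_bar_top n closure_of cell n E"
    proof
      fix p assume p: "p \<in> chart ` V \<inter> divisor \<inter> M0_bar_real n"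
      then obtain x where x: "x \<in> V" "p = chart x" by blast
      have "x 1 = 0" using chart_mem_D(1)[of x] p x Vsub by auto
      \<comment> \<open>Real cross-ratios force real coordinates, since each coordinate is a
        cross-ratio.\<close>
      moreover have "x j \<in> \<real>" if j: "j \<in> {1..n - 3}" for j
        using p chart_coord_quad[OF j, of x] coord_quad_mem[OF j] unfolding x(2) M0_bar_real_def by force
      ultimately show "p \<in> M0_bar_top n closure_of cell n E" using near x by blast
    qed
  qed
qed

end

lemma obtain_labelling:
  assumes "4 \<le> n" "a \<in> {1..<n} - {b, c}" "b \<in> {1..<n}" "c \<in> {1..<n}" "b \<noteq> c"
  obtains e where "bij_betw e ({1..<n} - {b, c}) {1..n - 3}" "e a = (1 :: nat)"
proof -
  have "card ({1..<n} - {b, c} - {a}) = card ({1..n - 3} - {1})"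
  proof -
    have "1 \<in> {1..n - 3}" using assms(1) by simp
    then have "card ({1..n - 3} - {1}) = n - 4" by (simp add: card_Diff_singleton)
    moreover have "card ({1..<n} - {b, c} - {a}) = n - 4"
      using assms by (simp add: card_Diff_subset)
    ultimately show ?thesis by (simp only:)
  qed
  then obtain h where h: "bij_betw h ({1..<n} - {b, c} - {a}) ({1..n - 3} - {1})"
    by (rule finite_same_card_bij[THEN exE, rotated 2]) simp_all
  have "bij_betw (h(a := 1)) ({1..<n} - {b, c} - {a} \<union> {a}) ({1..n - 3} - {1} \<union> {(h(a := 1)) a})"
  proof (rule notIn_Un_bij_betw)
    show "bij_betw (h(a := 1)) ({1..<n} - {b, c} - {a}) ({1..n - 3} - {1})"
      using h by (rule bij_betw_cong[THEN iffD1, rotated]) auto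
  qed auto
  moreover have "{1..<n} - {b, c} - {a} \<union> {a} = {1..<n} - {b, c}" "{1..n - 3} - {1} \<union> {(h(a := 1)) a} = {1..n - 3}"
    using assms by auto
  ultimately show thesis by (intro that[of "h(a := 1)"]) auto
qed

text \<open>If exactly one of \<open>1\<close>, \<open>n - 1\<close> lies in \<open>A\<close>, it
  becomes \<open>a0\<close> and the other \<open>b0\<close>; if both do, they become
  \<open>a0\<close> and \<open>a1\<close>; if neither does, \<open>n - 1\<close> becomes
  \<open>b0\<close>.\<close>

lemma obtain_normalized_chart:
  assumes n: "4 \<le> n" and A: "A \<subseteq> {1..<n}" "2 \<le> card A" "2 \<le> card ({1..n} - A)"
  obtains a0 a1 b0 e where "bdry_chart_normalized n A a0 a1 b0 e"
proof -
  have two: "\<exists>y\<in>S. y \<noteq> x" if "2 \<le> card S" for S and x :: nat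
    using that by (metis card_le_Suc0_iff_eq card.infinite not_less_eq_eq numeral_2_eq_2 zero_le)
  have A': "\<exists>a\<in>A. a \<noteq> x" for x using two A(2) by blast
  have lab: "\<exists>a0 a1 b0. a0 \<in> A \<and> a1 \<in> A \<and> a0 \<noteq> a1 \<and> b0 \<in> {1..<n} \<and> b0 \<notin> A \<and>
     ({a0, b0} = {1, n - 1} \<or> a0 = 1 \<and> a1 = n - 1 \<or> b0 = n - 1 \<and> 1 \<notin> A)"
  proof (cases "1 \<in> A")
    case True
    show ?thesis
    proof (cases "n - 1 \<in> A")
      case True
      \<comment> \<open>The complement of \<open>A\<close> has a second element besides
        \<open>n\<close>, as both blocks have at least two elements.\<close>
      obtain b0 where "b0 \<in> {1..n} - A" "b0 \<noteq> n" using two[OF A(3)] by blast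
      then show ?thesis
        using \<open>1 \<in> A\<close> True n by (intro exI[of _ 1] exI[of _ "n - 1"] exI[of _ b0]) auto
    next
      case False
      obtain a1 where "a1 \<in> A" "a1 \<noteq> 1" using A' by blast
      then show ?thesis
        using \<open>1 \<in> A\<close> False n by (intro exI[of _ 1] exI[of _ a1] exI[of _ "n - 1"]) auto
    qed
  next
    case False
    show ?thesis
    proof (cases "n - 1 \<in> A")
      case True
      obtain a1 where "a1 \<in> A" "a1 \<noteq> n - 1" using A' by blast
      then show ?thesis
        using \<open>1 \<notin> A\<close> True n by (intro exI[of _ "n - 1"] exI[of _ a1] exI[of _ 1]) auto
    next
      case nA: False
      obtain a0 where a0: "a0 \<in> A" using A' by blast
      obtain a1 where "a1 \<in> A" "a1 \<noteq> a0" using A' by blast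
      then show ?thesis
        using a0 False nA n by (intro exI[of _ a0] exI[of _ a1] exI[of _ "n - 1"]) auto
    qed
  qed
  then obtain a0 a1 b0 where l: "a0 \<in> A" "a1 \<in> A" "a0 \<noteq> a1" "b0 \<in> {1..<n}" "b0 \<notin> A"
     "{a0, b0} = {1, n - 1} \<or> a0 = 1 \<and> a1 = n - 1 \<or> b0 = n - 1 \<and> 1 \<notin> A" by blast
  obtain e where e: "bij_betw e ({1..<n} - {a0, b0}) {1..n - 3}" "e a1 = 1"
    by (rule obtain_labelling[of n a1 a0 b0]) (use n l A(1) in auto)
  show thesis
    by (rule that[of a0 a1 b0 e], unfold_locales) (use n l A(1) e in auto)
qed

theorem proposition2p7:
  fixes n :: nat and \<eta> \<gamma> :: "nat list set"
  assumes "4 \<le> n"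
    and "dihedral_structure n \<eta>"
    and "underlying_cyclic n \<eta> \<gamma>"
  shows "\<forall>D\<in>bdry_divisors n.
           (bounds_cell n \<eta> D \<longrightarrow> pole_of_order n (cell_form n \<gamma>) D 1) \<and>
           (\<not> bounds_cell n \<eta> D \<longrightarrow> no_pole n (cell_form n \<gamma>) D)"
proof
  fix X assume "X \<in> bdry_divisors n"
  then obtain S1 S2 where S: "X = bdry_divisor n S1 S2" "S1 \<union> S2 = {1..n}" "S1 \<inter> S2 = {}"
    "2 \<le> card S1" "2 \<le> card S2"
    unfolding bdry_divisors_def by blast
  \<comment> \<open>The block containing \<open>n\<close> includes the point at infinity, so the
    other block is taken as the cluster.\<close>
  obtain A where part: "A \<subseteq> {1..<n}" "2 \<le> card A" "2 \<le> card ({1..n} - A)" "X = bdry_divisor n A ({1..n} - A)"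
  proof -
    have n: "{1..n} - {n} = {1..<n}" by auto
    show thesis
    proof (cases "n \<in> S1")
      case True
      have "S2 \<subseteq> {1..n} - {n}" and S1: "{1..n} - S2 = S1" using S(2,3) True by blast+
      then show thesis
        using S bdry_divisor_commute[OF S(2,3)] unfolding n by (intro that[of S2]) (simp_all add: S1)
    next
      case False
      have "S1 \<subseteq> {1..n} - {n}" and S2: "{1..n} - S1 = S2" using S(2,3) False by blast+
      then show thesis
        using S unfolding n by (intro that[of S1]) (simp_all add: S2)
    qed
  qed
  obtain a0 a1 b0 e where "bdry_chart_normalized n A a0 a1 b0 e"
    using obtain_normalized_chart[OF assms(1) part(1-3)] .
  then interpret bdry_chart_normalized n A a0 a1 b0 e .
  have "1 \<le> n" using assms(1) by simp
  with assms(2,3) obtain ys where ys: "distinct (ys @ [n])" "set (ys @ [n]) = {1..n}" "rep_ending n \<gamma> = ys @ [n]"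
    and E: "\<And>xs. xs \<in> \<eta> \<and> last xs = n \<longleftrightarrow> xs = ys @ [n] \<or> xs = rev ys @ [n]"
    by (rule obtain_rep_ending) blast
  have "A \<subseteq> set ys" using part(1) butlast_rep(2)[OF ys(1,2)] by simp
  moreover have "A \<noteq> {}" using a01 by auto
  moreover have "distinct ys" using ys(1) by simp
  ultimately have card: "consecutive_in ys A \<Longrightarrow> card (adjacent_in ys A) + 1 = card A"
    "\<not> consecutive_in ys A \<Longrightarrow> card (adjacent_in ys A) + 2 \<le> card A"
    using card_adjacent_in by blast+
  note order = form_order_cell_form[OF ys, folded part(4)]
  show "(bounds_cell n \<eta> X \<longrightarrow> pole_of_order n (cell_form n \<gamma>) X 1) \<and>
        (\<not> bounds_cell n \<eta> X \<longrightarrow> no_pole n (cell_form n \<gamma>) X)"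
  proof (cases "consecutive_in ys A")
    case True
    have "bounds_cell n \<eta> X"
      unfolding part(4) using E True by (intro consecutive_imp_bounds_cell[OF ys(1,2)]) blast+
    moreover have exponent: "int (card A) - 2 - int (card (adjacent_in ys A)) = - int 1"
      using card(1)[OF True] by simp
    ultimately show ?thesis using order unfolding exponent by (simp add: pole_of_order_def)
  next
    case False
    have "\<not> bounds_cell n \<eta> X"
      unfolding part(4) using E False by (intro not_consecutive_imp_not_bounds_cell[OF ys(1,2)]) blast+
    moreover have "0 \<le> int (card A) - 2 - int (card (adjacent_in ys A))"
      using card(2)[OF False] by simp
    ultimately show ?thesis using order unfolding no_pole_def by blast
  qed
qed

end
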